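(* Let $d\geq 4$. For all sufficiently large $n$, for every integer $f$ with $f_{max}(n,d-1)\leq f\leq f_{max}(n,d)$ there exists an arrangement of $n$ distinct hyperplanes in $\mathbb{RP}^d$ with exactly $f$ regions.
   Context: An arrangement of $n$ hyperplanes in real projective space $\mathbb{RP}^d$ is a set of $n$ distinct projective hyperplanes. Its number of regions is the number of connected components of the complement in $\mathbb{RP}^d$ of the union of its hyperplanes. $f_{max}(n,d)$ denotes the maximal possible number of regions of an arrangement of $n$ hyperplanes in $\mathbb{RP}^d$; for $n\geq d+1$ it equals $\sum_{i=0}^{d}\binom{n-1}{i}$. *)

theory Defs
  imports "HOL-Analysis.Analysis"
begin

text \<open>
  The dimension d varies within the statement, so real d-space is modelled by the
  library's \<^const>\<open>Euclidean_space\<close> (functions \<^typ>\<open>nat \<Rightarrow> real\<close> vanishing from index d on)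
  rather than by an index type.
\<close>

definition punctured_space :: "nat \<Rightarrow> (nat \<Rightarrow> real) topology" where
  "punctured_space m = subtopology (Euclidean_space m) (- {\<lambda>_. 0})"

text \<open>A point of projective space is the one-dimensional linear subspace itself (including 0).\<close>

definition line_through :: "(nat \<Rightarrow> real) \<Rightarrow> (nat \<Rightarrow> real) set" where
  "line_through x = range (\<lambda>c i. c * x i)"

definition real_projective_space :: "nat \<Rightarrow> (nat \<Rightarrow> real) set topology" where
  "real_projective_space d = topology (\<lambda>U.
     U \<subseteq> line_through ` topspace (punctured_space (Suc d)) \<and>
     openin (punctured_space (Suc d)) {x \<in> topspace (punctured_space (Suc d)). line_through x \<in> U})"

lemma openin_real_projective_space:
  "openin (real_projective_space d) U \<longleftrightarrow>
     U \<subseteq> line_through ` topspace (punctured_space (Suc d)) \<and>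
     openin (punctured_space (Suc d)) {x \<in> topspace (punctured_space (Suc d)). line_through x \<in> U}"
proof -
  let ?X = "punctured_space (Suc d)"
  let ?P = "\<lambda>U. {x \<in> topspace ?X. line_through x \<in> U}"
  have "?P (S \<inter> T) = ?P S \<inter> ?P T" for S T by auto
  moreover have "?P (\<Union>K) = \<Union>(?P ` K)" for K by auto
  ultimately have "istopology (\<lambda>U. U \<subseteq> line_through ` topspace ?X \<and> openin ?X (?P U))"
    unfolding istopology_def by (auto intro!: openin_Union simp del: UN_simps)
  then show ?thesis
    unfolding real_projective_space_def by (simp add: topology_inverse')
qed

lemma topspace_real_projective_space:
  "topspace (real_projective_space d) = line_through ` topspace (punctured_space (Suc d))"
proof
  show "topspace (real_projective_space d) \<subseteq> line_through ` topspace (punctured_space (Suc d))"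
    using openin_real_projective_space openin_topspace by blast
  have "{x \<in> topspace (punctured_space (Suc d)).
          line_through x \<in> line_through ` topspace (punctured_space (Suc d))}
        = topspace (punctured_space (Suc d))" by auto
  then have "openin (real_projective_space d) (line_through ` topspace (punctured_space (Suc d)))"
    by (simp add: openin_real_projective_space)
  then show "line_through ` topspace (punctured_space (Suc d)) \<subseteq> topspace (real_projective_space d)"
    by (rule openin_subset)
qed

lemma quotient_map_line_through:
  "quotient_map (punctured_space (Suc d)) (real_projective_space d) line_through"
  by (simp add: quotient_map_def topspace_real_projective_space openin_real_projective_space)

definition projective_hyperplane :: "nat \<Rightarrow> (nat \<Rightarrow> real) set set \<Rightarrow> bool" where
  "projective_hyperplane d H \<longleftrightarrow>
     (\<exists>a. (\<exists>i\<le>d. a i \<noteq> 0) \<and>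
          H = {l \<in> topspace (real_projective_space d). \<forall>x\<in>l. (\<Sum>i\<le>d. a i * x i) = 0})"

definition arrangement :: "nat \<Rightarrow> nat \<Rightarrow> (nat \<Rightarrow> real) set set set \<Rightarrow> bool" where
  "arrangement n d A \<longleftrightarrow> finite A \<and> card A = n \<and> (\<forall>H\<in>A. projective_hyperplane d H)"

definition regions :: "nat \<Rightarrow> (nat \<Rightarrow> real) set set set \<Rightarrow> (nat \<Rightarrow> real) set set set" where
  "regions d A = connected_components_of
     (subtopology (real_projective_space d) (topspace (real_projective_space d) - \<Union>A))"

text \<open>
  The set below is finite, and nonempty when d > 0. For d = 0 the only hyperplane is
  empty, so there is no arrangement with n > 1 and the value is unspecified.
\<close>

definition f_max :: "nat \<Rightarrow> nat \<Rightarrow> nat" where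
  "f_max n d = Max {card (regions d A) |A. arrangement n d A}"

end

theory Submission
  imports Defs "HOL-Library.Function_Algebras"
begin

text \<open>
  Regions of a projective arrangement correspond, two to one, to the sign patterns which the
  defining linear forms realize on \<open>(d + 1)\<close>-space, and sign patterns are counted by
  deletion and restriction. Write \<open>e = d - 1\<close>. Two families of arrangements realize all values.

  In the first family the hyperplanes are generic except that disjoint sets of
  \<open>k\<^sub>1, k\<^sub>2, \<dots>\<close> hyperplanes pass through points; each point costs \<open>(k\<^sub>j - 1) choose d\<close>
  regions. By a greedy expansion these deficits reach every number up to nearly the full
  \<open>(n - 1) choose d\<close>.

  For larger deficits, \<open>n - m\<close> hyperplanes pass through a common point, where \<open>m \<ge> 2\<close> is a
  small fraction of \<open>n\<close>. This costs \<open>(n - m - 1) choose d\<close> regions; letting \<open>k\<^sub>j\<close> of them share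
  a line costs another \<open>(m + 1) * ((k\<^sub>j - 1) choose e)\<close>, and letting the intersection of two of
  the other hyperplanes meet \<open>s \<le> m\<close> vertices supplies the remainder modulo \<open>m + 1\<close>.
\<close>

section \<open>Sign patterns of linear forms\<close>

text \<open>Disjoint groups alone cannot finish: the greedy expansion of a deficit near
  \<open>(n - 1) choose d\<close> begins with a group of almost all hyperplanes and leaves too few
  for the remainder. In the cone only a quotient by \<open>m + 1 \<ge> 3\<close> is expanded. It is
  at most two thirds of \<open>(n - 2) choose e\<close>, and the missing third frees about
  \<open>n / (3 * e)\<close> hyperplanes. These pay for the \<open>m\<close> hyperplanes outside the
  cone, for the \<open>s\<close> vertices and for the overhead of the greedy expansion. The factor
  \<open>m + 1\<close> counts the places where the base of the cone is seen: the cone itself and the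
  trace on each outside hyperplane. A loss in the base recurs in all of them. A vertex on the
  intersection of two outside hyperplanes is seen in one trace only and costs 1. Prescribed
  incidences must be realized by actual real forms. Groups share at most one form, and that form is
  chosen first; so each later form has to pass through at most one prescribed point, and is
  otherwise kept generic by finitely many conditions of nonvanishing.\<close>

definition cells :: "'v::real_vector set \<Rightarrow> ('i \<Rightarrow> 'v \<Rightarrow> real) \<Rightarrow> 'i set \<Rightarrow> 'i set set" where
  "cells V a I = {J. J \<subseteq> I \<and> (\<exists>x\<in>V. (\<forall>i\<in>J. a i x > 0) \<and> (\<forall>i\<in>I - J. a i x < 0))}"

lemma finite_cells: "finite I \<Longrightarrow> finite (cells V a I)"
  unfolding cells_def by (rule finite_subset[of _ "Pow I"]) auto

lemma cells_cong:
  assumes "\<And>i x. i \<in> I \<Longrightarrow> x \<in> V \<Longrightarrow> a i x = b i x"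
  shows "cells V a I = cells V b I"
proof -
  have "(\<exists>x\<in>V. (\<forall>i\<in>J. a i x > 0) \<and> (\<forall>i\<in>I - J. a i x < 0)) \<longleftrightarrow>
      (\<exists>x\<in>V. (\<forall>i\<in>J. b i x > 0) \<and> (\<forall>i\<in>I - J. b i x < 0))" if "J \<subseteq> I" for J
    using assms that by (intro bex_cong refl conj_cong ball_cong) (auto simp: subset_iff)
  then show ?thesis
    unfolding cells_def by blast
qed

lemma cells_empty_index: "x \<in> V \<Longrightarrow> cells V a {} = {{}}"
  unfolding cells_def by auto

lemma cells_eq_empty:
  assumes "i \<in> I" "\<And>x. x \<in> V \<Longrightarrow> a i x = 0"
  shows "cells V a I = {}"
proof -
  have "\<not> (\<exists>x\<in>V. (\<forall>i\<in>J. a i x > 0) \<and> (\<forall>i\<in>I - J. a i x < 0))" for J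
  proof (cases "i \<in> J")
    case True
    then show ?thesis using assms by fastforce
  next
    case False
    then show ?thesis using assms by (metis DiffI less_irrefl)
  qed
  then show ?thesis
    unfolding cells_def by blast
qed

text \<open>Continuity at \<open>t = 0\<close> for finitely many strict inequalities. Both signs of
  the perturbation are kept because a point of a hyperplane will be moved to either side of
  it.\<close>

lemma small_perturbation:
  fixes a b :: "'i \<Rightarrow> real"
  assumes "finite I"
  shows "\<exists>t>0. \<forall>i\<in>I. (a i > 0 \<longrightarrow> a i + t * b i > 0 \<and> a i - t * b i > 0)
                   \<and> (a i < 0 \<longrightarrow> a i + t * b i < 0 \<and> a i - t * b i < 0)"
proof -
  have "\<forall>\<^sub>F t in at_right 0. (a i > 0 \<longrightarrow> a i + t * b i > 0 \<and> a i - t * b i > 0)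
                   \<and> (a i < 0 \<longrightarrow> a i + t * b i < 0 \<and> a i - t * b i < 0)" for i
  proof -
    have "((\<lambda>t. a i + t * b i) \<longlongrightarrow> a i + 0 * b i) (at_right 0)"
      "((\<lambda>t. a i - t * b i) \<longlongrightarrow> a i - 0 * b i) (at_right 0)"
      by (intro tendsto_intros)+
    then have l: "((\<lambda>t. a i + t * b i) \<longlongrightarrow> a i) (at_right 0)"
      "((\<lambda>t. a i - t * b i) \<longlongrightarrow> a i) (at_right 0)"
      by simp_all
    consider "a i > 0" | "a i < 0" | "a i = 0" by linarith
    then show ?thesis
    proof cases
      case 1
      from order_tendstoD(1)[OF l(1) 1] order_tendstoD(1)[OF l(2) 1] show ?thesis
        by eventually_elim (use 1 in auto)
    next
      case 2
      from order_tendstoD(2)[OF l(1) 2] order_tendstoD(2)[OF l(2) 2] show ?thesis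
        by eventually_elim (use 2 in auto)
    qed auto
  qed
  then have "\<forall>\<^sub>F t in at_right 0. \<forall>i\<in>I. (a i > 0 \<longrightarrow> a i + t * b i > 0 \<and> a i - t * b i > 0)
                   \<and> (a i < 0 \<longrightarrow> a i + t * b i < 0 \<and> a i - t * b i < 0)"
    using assms by (intro eventually_ball_finite) auto
  moreover have "\<forall>\<^sub>F t in at_right (0::real). t > 0"
    by (simp add: eventually_at_right_less)
  ultimately have "\<forall>\<^sub>F t in at_right 0. t > 0 \<and> (\<forall>i\<in>I. (a i > 0 \<longrightarrow> a i + t * b i > 0 \<and> a i - t * b i > 0)
                   \<and> (a i < 0 \<longrightarrow> a i + t * b i < 0 \<and> a i - t * b i < 0))"
    by eventually_elim auto
  then show ?thesis
    using eventually_happens trivial_limit_at_right_real by blast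
qed

text \<open>Cells are taken relative to a set \<open>V\<close> inside a fixed type, so restriction
  to a hyperplane only shrinks \<open>V\<close> and keeps the forms unchanged.\<close>

abbreviation ker_in :: "'v set \<Rightarrow> ('v \<Rightarrow> real) \<Rightarrow> 'v set" where
  "ker_in V h \<equiv> V \<inter> {x. h x = 0}"

lemma subspace_ker_in: "subspace V \<Longrightarrow> linear h \<Longrightarrow> subspace (ker_in V h)"
  by (intro subspace_inter) (auto simp: subspace_def linear_0 linear_add linear_scale)

text \<open>Deletion and restriction. Let \<open>P\<close> and \<open>Q\<close> be the patterns on
  \<open>I\<close> that occur with form \<open>h\<close> positive and negative. The three counts are
  \<open>card P + card Q\<close>, \<open>card (P \<union> Q)\<close> and
  \<open>card (P \<inter> Q)\<close>: a point of the hyperplane can be pushed to either side, and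
  two points on opposite sides have a positive combination on it.\<close>

lemma card_cells_insert:
  fixes a :: "'i \<Rightarrow> 'v::real_vector \<Rightarrow> real"
  assumes V: "subspace V" and fin: "finite I" and "h \<notin> I" and lin: "\<And>i. linear (a i)"
    and nz: "\<exists>x\<in>V. a h x \<noteq> 0"
  shows "card (cells V a (insert h I)) = card (cells V a I) + card (cells (ker_in V (a h)) a I)"
proof -
  define P where "P = {J. J \<subseteq> I \<and> (\<exists>x\<in>V. a h x > 0 \<and> (\<forall>i\<in>J. a i x > 0) \<and> (\<forall>i\<in>I - J. a i x < 0))}"
  define Q where "Q = {J. J \<subseteq> I \<and> (\<exists>x\<in>V. a h x < 0 \<and> (\<forall>i\<in>J. a i x > 0) \<and> (\<forall>i\<in>I - J. a i x < 0))}"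
  have fPQ: "finite P" "finite Q"
    unfolding P_def Q_def using fin by (auto intro: finite_subset[of _ "Pow I"])
  obtain y where y: "y \<in> V" "a h y > 0"
  proof -
    obtain x where x: "x \<in> V" "a h x \<noteq> 0" using nz by blast
    show ?thesis
    proof (cases "a h x > 0")
      case False
      then show ?thesis using x that[of "- x"] V lin by (auto simp: subspace_neg linear_neg)
    qed (use x that in blast)
  qed
  have val: "a i (x + t *\<^sub>R z) = a i x + t * a i z" for i x t z
    using lin[of i] by (simp add: linear_add linear_scale)
  have val': "a i (x - t *\<^sub>R z) = a i x - t * a i z" for i x t z
    using lin[of i] by (simp add: linear_diff linear_scale)
  have inV: "x + t *\<^sub>R z \<in> V" "x - t *\<^sub>R z \<in> V" if "x \<in> V" "z \<in> V" for x t z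
    using V that by (auto intro: subspace_add subspace_diff subspace_scale)
  have pert: "J \<in> P \<and> J \<in> Q" if J: "J \<in> cells V a I" and x: "x \<in> V" "\<forall>i\<in>J. a i x > 0"
    "\<forall>i\<in>I - J. a i x < 0" "a h x = 0" for J x
  proof -
    obtain t where t: "t > 0" "\<forall>i\<in>I. (a i x > 0 \<longrightarrow> a i x + t * a i y > 0 \<and> a i x - t * a i y > 0)
                   \<and> (a i x < 0 \<longrightarrow> a i x + t * a i y < 0 \<and> a i x - t * a i y < 0)"
      using small_perturbation[OF fin, of "\<lambda>i. a i x" "\<lambda>i. a i y"] by blast
    have JI: "J \<subseteq> I" using J by (auto simp: cells_def)
    have "J \<in> P"
      unfolding P_def using JI t x y inV
      by (auto simp: val subset_iff intro!: bexI[of _ "x + t *\<^sub>R y"])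
    moreover have "J \<in> Q"
      unfolding Q_def using JI t x y inV
      by (auto simp: val' subset_iff intro!: bexI[of _ "x - t *\<^sub>R y"])
    ultimately show ?thesis ..
  qed
  have un: "cells V a I = P \<union> Q"
  proof (intro equalityI subsetI)
    fix J assume J: "J \<in> cells V a I"
    then obtain x where x: "x \<in> V" "\<forall>i\<in>J. a i x > 0" "\<forall>i\<in>I - J. a i x < 0" and "J \<subseteq> I"
      by (auto simp: cells_def)
    consider "a h x > 0" | "a h x < 0" | "a h x = 0" by linarith
    then show "J \<in> P \<union> Q"
      using x \<open>J \<subseteq> I\<close> pert[OF J x] by cases (auto simp: P_def Q_def)
  qed (auto simp: P_def Q_def cells_def)
  have int: "cells (ker_in V (a h)) a I = P \<inter> Q"
  proof (intro equalityI subsetI)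
    fix J assume J: "J \<in> cells (ker_in V (a h)) a I"
    then have "J \<in> cells V a I" by (auto simp: cells_def)
    with J pert show "J \<in> P \<inter> Q" by (auto simp: cells_def)
  next
    fix J assume "J \<in> P \<inter> Q"
    then obtain x z where x: "x \<in> V" "a h x > 0" "\<forall>i\<in>J. a i x > 0" "\<forall>i\<in>I - J. a i x < 0"
      and z: "z \<in> V" "a h z < 0" "\<forall>i\<in>J. a i z > 0" "\<forall>i\<in>I - J. a i z < 0" and JI: "J \<subseteq> I"
      by (auto simp: P_def Q_def)
    \<comment> \<open>Both coefficients are positive, so \<open>w\<close> keeps the signs that
      \<open>x\<close> and \<open>z\<close> share on \<open>I\<close>, while the values of form
      \<open>h\<close> cancel.\<close>
    define w where "w = (- a h z) *\<^sub>R x + a h x *\<^sub>R z"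
    have w: "a i w = (- a h z) * a i x + a h x * a i z" for i
      using lin[of i] by (simp add: w_def linear_add linear_scale linear_diff linear_neg)
    have "w \<in> V" using x(1) z(1) V by (auto simp: w_def intro: subspace_add subspace_scale subspace_neg subspace_diff)
    moreover have "a h w = 0" by (simp add: w)
    moreover have "a i w > 0" if "i \<in> J" for i
    proof -
      have "0 < (- a h z) * a i x" "0 < a h x * a i z"
        using that x z by (auto intro!: mult_neg_neg mult_pos_pos simp: mult_neg_pos)
      then show ?thesis unfolding w by linarith
    qed
    moreover have "a i w < 0" if "i \<in> I - J" for i
    proof -
      have "(- a h z) * a i x < 0" "a h x * a i z < 0"
        using that x z by (auto intro!: mult_pos_neg mult_neg_neg)
      then show ?thesis unfolding w by linarith
    qed
    ultimately show "J \<in> cells (ker_in V (a h)) a I"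
      using JI by (auto simp: cells_def)
  qed
  have split: "cells V a (insert h I) = insert h ` P \<union> Q"
  proof (intro equalityI subsetI)
    fix J assume "J \<in> cells V a (insert h I)"
    then obtain x where x: "x \<in> V" "\<forall>i\<in>J. a i x > 0" "\<forall>i\<in>insert h I - J. a i x < 0"
      and JI: "J \<subseteq> insert h I" by (auto simp: cells_def)
    show "J \<in> insert h ` P \<union> Q"
    proof (cases "h \<in> J")
      case True
      then have "J - {h} \<in> P" using x JI \<open>h \<notin> I\<close> by (auto simp: P_def)
      then show ?thesis using True by (metis UnI1 imageI insert_Diff)
    next
      case False
      then have "J \<in> Q" using x JI \<open>h \<notin> I\<close> by (auto simp: Q_def)
      then show ?thesis by blast
    qed
  next
    fix J assume "J \<in> insert h ` P \<union> Q"
    then show "J \<in> cells V a (insert h I)"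
      using \<open>h \<notin> I\<close> by (fastforce simp: P_def Q_def cells_def)
  qed
  have "inj_on (insert h) P"
    using \<open>h \<notin> I\<close> by (auto simp: inj_on_def P_def)
  moreover have "insert h ` P \<inter> Q = {}"
    using \<open>h \<notin> I\<close> by (auto simp: P_def Q_def)
  ultimately have "card (cells V a (insert h I)) = card P + card Q"
    unfolding split using fPQ by (simp add: card_Un_disjoint card_image)
  also have "\<dots> = card (P \<union> Q) + card (P \<inter> Q)"
    using fPQ by (rule card_Un_Int)
  finally show ?thesis using un int by simp
qed

section \<open>Dimension of subspaces and independence of forms\<close>

definition has_dim :: "'v::real_vector set \<Rightarrow> nat \<Rightarrow> bool" where
  "has_dim V k \<longleftrightarrow> (\<exists>B. finite B \<and> card B = k \<and> independent B \<and> span B = V)"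

text \<open>Surjectivity of the evaluation map from \<open>V\<close> to value vectors on
  \<open>S\<close>. For finite \<open>S\<close> this is linear independence of the restrictions to
  \<open>V\<close>, without the dual space. The family is indexed: one form under two indices counts
  as dependent.\<close>

definition indep_on :: "'v::real_vector set \<Rightarrow> ('i \<Rightarrow> 'v \<Rightarrow> real) \<Rightarrow> 'i set \<Rightarrow> bool" where
  "indep_on V a S \<longleftrightarrow> (\<forall>c. \<exists>x\<in>V. \<forall>i\<in>S. a i x = c i)"

lemma has_dim_subspace: "has_dim V k \<Longrightarrow> subspace V"
  unfolding has_dim_def by auto

lemma has_dim_0: "has_dim V 0 \<Longrightarrow> V = {0}"
  unfolding has_dim_def by auto

lemma has_dim_1:
  assumes "has_dim V 1"
  obtains b where "b \<in> V" "b \<noteq> 0" "\<And>x. x \<in> V \<Longrightarrow> \<exists>c. x = c *\<^sub>R b"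
proof -
  obtain B where B: "card B = 1" "independent B" "span B = V"
    using assms unfolding has_dim_def by auto
  then obtain b where "B = {b}" by (meson card_1_singletonE)
  with B have "b \<noteq> 0" "V = range (\<lambda>k. k *\<^sub>R b)"
    by (auto simp: span_singleton dependent_single)
  moreover have "b \<in> span {b}" by (simp add: span_base)
  ultimately show ?thesis
    using that[of b] B \<open>B = {b}\<close> by blast
qed

lemma has_dim_outside_line:
  assumes "has_dim V k" "2 \<le> k"
  shows "\<exists>x\<in>V. x \<notin> span {p}"
proof (rule ccontr)
  assume c: "\<not> ?thesis"
  obtain B where B: "card B = k" "independent B" "span B = V"
    using assms unfolding has_dim_def by auto
  then have "B \<subseteq> span {p}"
    using c span_superset[of B] by auto
  then have "card B \<le> card {p}"
    using independent_span_bound[of "{p}" B] B by auto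
  with B assms show False by simp
qed

lemma has_dim_nonzero:
  assumes "has_dim V k" "1 \<le> k"
  shows "\<exists>x\<in>V. x \<noteq> 0"
proof -
  obtain B where B: "card B = k" "independent B" "span B = V"
    using assms unfolding has_dim_def by auto
  with assms obtain b where "b \<in> B" by fastforce
  then show ?thesis
    using B span_base[of b B] dependent_zero[of B] by metis
qed

text \<open>A basis of the kernel becomes a basis of \<open>V\<close> when any vector with a nonzero
  value of \<open>h\<close> is added.\<close>

lemma has_dim_ker:
  assumes "has_dim V (Suc k)" "linear h" "\<exists>x\<in>V. h x \<noteq> 0"
  shows "has_dim (ker_in V h) k"
proof -
  obtain B where B: "finite B" "card B = Suc k" "independent B" "span B = V"
    using assms unfolding has_dim_def by auto
  have V: "subspace V" using assms(1) by (rule has_dim_subspace)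
  obtain x where x: "x \<in> V" "h x \<noteq> 0" using assms by blast
  obtain C where C: "C \<subseteq> ker_in V h" "independent C" "ker_in V h \<subseteq> span C"
    using basis_exists by metis
  have spC: "span C = ker_in V h"
    using C span_minimal[OF C(1) subspace_ker_in[OF V assms(2)]] by blast
  have xC: "x \<notin> span C" using x spC by auto
  have ind: "independent (insert x C)" using C(2) xC by (simp add: independent_insertI)
  have sp: "span (insert x C) = V"
  proof
    show "span (insert x C) \<subseteq> V"
      using x C V by (intro span_minimal) auto
    show "V \<subseteq> span (insert x C)"
    proof
      fix v assume v: "v \<in> V"
      have "v - (h v / h x) *\<^sub>R x \<in> ker_in V h"
        using v x V assms(2) by (auto simp: subspace_diff subspace_scale linear_diff linear_scale)
      then show "v \<in> span (insert x C)"
        unfolding span_breakdown_eq spC by blast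
    qed
  qed
  have f: "finite (insert x C)" and le: "card (insert x C) \<le> card B"
    using independent_span_bound[OF B(1) ind] B(2,4) sp span_superset[of "insert x C"] by auto
  have "card B \<le> card (insert x C)"
    using independent_span_bound[OF f B(3)] B(4) sp span_superset[of B] by auto
  with le B have "card (insert x C) = Suc k" by simp
  moreover have "x \<notin> C" using xC span_superset by blast
  ultimately have "card C = k" using f by simp
  then show ?thesis
    unfolding has_dim_def using f C(2) spC by auto
qed

lemma indep_on_mono: "indep_on V a T \<Longrightarrow> S \<subseteq> T \<Longrightarrow> indep_on V a S"
  unfolding indep_on_def by blast

lemma indep_on_empty: "subspace V \<Longrightarrow> indep_on V a {}"
  unfolding indep_on_def using subspace_0 by blast

lemma indep_on_cong:
  assumes "\<And>i x. i \<in> S \<Longrightarrow> x \<in> V \<Longrightarrow> a i x = b i x"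
  shows "indep_on V a S \<longleftrightarrow> indep_on V b S"
  unfolding indep_on_def using assms by (metis (no_types, lifting))

text \<open>A common zero of \<open>S\<close> on which form \<open>i\<close> does not vanish serves
  to correct the value at \<open>i\<close> without disturbing the values on
  \<open>S\<close>.\<close>

lemma indep_on_insert:
  fixes a :: "'i \<Rightarrow> 'v::real_vector \<Rightarrow> real"
  assumes V: "subspace V" and lin: "\<And>i. linear (a i)" and "i \<notin> S"
  shows "indep_on V a (insert i S) \<longleftrightarrow>
    indep_on V a S \<and> (\<exists>x\<in>V. (\<forall>j\<in>S. a j x = 0) \<and> a i x \<noteq> 0)"
proof (intro iffI conjI)
  assume L: "indep_on V a (insert i S)"
  then show "indep_on V a S" by (rule indep_on_mono) auto
  have "\<exists>x\<in>V. \<forall>j\<in>insert i S. a j x = (if j = i then 1 else 0)"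
    using L unfolding indep_on_def by fast
  then obtain x where x: "x \<in> V" "\<And>j. j \<in> insert i S \<Longrightarrow> a j x = (if j = i then 1 else 0)"
    by blast
  then show "\<exists>x\<in>V. (\<forall>j\<in>S. a j x = 0) \<and> a i x \<noteq> 0"
    using \<open>i \<notin> S\<close> by (intro bexI[of _ x]) auto
next
  assume R: "indep_on V a S \<and> (\<exists>x\<in>V. (\<forall>j\<in>S. a j x = 0) \<and> a i x \<noteq> 0)"
  then obtain x where x: "x \<in> V" "\<forall>j\<in>S. a j x = 0" "a i x \<noteq> 0" by blast
  show "indep_on V a (insert i S)"
    unfolding indep_on_def
  proof
    fix c
    obtain y where y: "y \<in> V" "\<forall>j\<in>S. a j y = c j" using R unfolding indep_on_def by blast
    define z where "z = y + ((c i - a i y) / a i x) *\<^sub>R x"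
    have z: "a j z = a j y + ((c i - a i y) / a i x) * a j x" for j
      using lin[of j] by (simp add: z_def linear_add linear_scale)
    have "z \<in> V" using V x y by (simp add: z_def subspace_add subspace_scale)
    moreover have "\<forall>j\<in>insert i S. a j z = c j"
      using x y by (simp add: z)
    ultimately show "\<exists>x\<in>V. \<forall>j\<in>insert i S. a j x = c j" by blast
  qed
qed

text \<open>Contraction of the matroid by \<open>i\<close>: restricting to a hyperplane amounts to
  keeping its form in every set that is tested.\<close>

lemma indep_on_ker:
  fixes a :: "'i \<Rightarrow> 'v::real_vector \<Rightarrow> real"
  assumes V: "subspace V" and lin: "\<And>i. linear (a i)" and "i \<notin> S" and "\<exists>x\<in>V. a i x \<noteq> 0"
  shows "indep_on (ker_in V (a i)) a S \<longleftrightarrow> indep_on V a (insert i S)"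
proof
  assume L: "indep_on V a (insert i S)"
  show "indep_on (ker_in V (a i)) a S"
    unfolding indep_on_def
  proof
    fix c
    have "\<exists>x\<in>V. \<forall>j\<in>insert i S. a j x = (c(i := 0)) j"
      using L unfolding indep_on_def by blast
    then obtain x where x: "x \<in> V" "\<And>j. j \<in> insert i S \<Longrightarrow> a j x = (c(i := 0)) j"
      by blast
    then show "\<exists>x\<in>ker_in V (a i). \<forall>j\<in>S. a j x = c j"
      using \<open>i \<notin> S\<close> by (intro bexI[of _ x]) auto
  qed
next
  assume R: "indep_on (ker_in V (a i)) a S"
  obtain x where x: "x \<in> V" "a i x \<noteq> 0" using assms by blast
  show "indep_on V a (insert i S)"
    unfolding indep_on_def
  proof
    fix c
    define t where "t = c i / a i x"
    \<comment> \<open>The shifted targets compensate for the multiple \<open>t *\<^sub>R x\<close>,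
      which is added at the end to attain \<open>c i\<close>.\<close>
    obtain y where y: "y \<in> V" "a i y = 0" "\<forall>j\<in>S. a j y = c j - t * a j x"
      using R unfolding indep_on_def by (drule_tac x = "\<lambda>j. c j - t * a j x" in spec) auto
    have "a j (y + t *\<^sub>R x) = a j y + t * a j x" for j
      using lin[of j] by (simp add: linear_add linear_scale)
    then show "\<exists>x\<in>V. \<forall>j\<in>insert i S. a j x = c j"
      using x y V by (intro bexI[of _ "y + t *\<^sub>R x"]) (auto simp: t_def subspace_add subspace_scale)
  qed
qed

lemma has_dim_common_zeros:
  fixes a :: "'i \<Rightarrow> 'v::real_vector \<Rightarrow> real"
  assumes lin: "\<And>i. linear (a i)"
  assumes "finite S" "has_dim V k" "indep_on V a S"
  shows "card S \<le> k \<and> has_dim {x\<in>V. \<forall>i\<in>S. a i x = 0} (k - card S)"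
  using assms(2-)
proof (induction S arbitrary: V k)
  case (insert i S)
  have V: "subspace V" using insert.prems has_dim_subspace by blast
  have nz: "\<exists>x\<in>V. a i x \<noteq> 0"
    using insert.prems(2) indep_on_insert[of V a i S, OF V lin insert.hyps(2)] by blast
  moreover have "a i 0 = 0" using lin by (simp add: linear_0)
  ultimately obtain k' where k: "k = Suc k'"
    using insert.prems(1) has_dim_0 by (cases k) fastforce+
  have "has_dim (ker_in V (a i)) k'"
    using has_dim_ker[of V k' "a i"] insert.prems k nz lin by blast
  moreover have "indep_on (ker_in V (a i)) a S"
    using indep_on_ker[of V a i S, OF V lin insert.hyps(2) nz] insert.prems by blast
  ultimately have "card S \<le> k' \<and> has_dim {x \<in> ker_in V (a i). \<forall>i\<in>S. a i x = 0} (k' - card S)"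
    by (rule insert.IH)
  moreover have "{x \<in> ker_in V (a i). \<forall>i\<in>S. a i x = 0} = {x \<in> V. \<forall>i\<in>insert i S. a i x = 0}"
    by auto
  ultimately show ?case
    using insert.hyps k by simp
qed auto

section \<open>Paving arrangements\<close>

text \<open>\<open>D\<close> is the dimension of the linear space, so this is the claimed maximum in
  projective dimension \<open>D - 1\<close>.\<close>

definition regs :: "nat \<Rightarrow> nat \<Rightarrow> nat" where
  "regs n D = (\<Sum>i<D. (n - 1) choose i)"

text \<open>
  The number of regions lost when \<open>k\<close> otherwise generic forms have rank only \<open>D - 1\<close>. The value
  at \<open>k = 0\<close> is fixed separately because truncated subtraction would give \<open>1\<close> for \<open>D = 1\<close>.
\<close>

definition deficit :: "nat \<Rightarrow> nat \<Rightarrow> nat" where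
  "deficit k D = (if k = 0 then 0 else (k - 1) choose (D - 1))"

lemma regs_dim_1 [simp]: "regs n (Suc 0) = 1"
  by (simp add: regs_def)

lemma regs_1 [simp]: "D \<ge> Suc 0 \<Longrightarrow> regs (Suc 0) D = 1"
  by (cases D) (simp_all add: regs_def sum.lessThan_Suc_shift del: sum.lessThan_Suc)

lemma regs_Suc: "n \<ge> 1 \<Longrightarrow> regs (Suc n) (Suc D) = regs n (Suc D) + regs n D"
proof (cases n)
  case (Suc k)
  have "(\<Sum>i<Suc D. Suc k choose i) = (\<Sum>i<Suc D. k choose i) + (\<Sum>i<D. k choose i)"
    by (induction D) auto
  then show ?thesis by (simp add: regs_def Suc)
qed simp

lemma deficit_small: "k < D \<Longrightarrow> deficit k D = 0"
  by (auto simp: deficit_def)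

text \<open>The same Pascal recurrence that cell counts obey. A group through the removed form loses
  a member under deletion and under restriction, but only restriction lowers the rank.\<close>

lemma deficit_Suc: "D \<ge> 1 \<Longrightarrow> deficit (Suc k) (Suc D) = deficit k (Suc D) + deficit k D"
  by (cases k; cases D) (auto simp: deficit_def)

lemma cells_zero_space: "linear (a i) \<Longrightarrow> i \<in> I \<Longrightarrow> cells {0} a I = {}"
  by (rule cells_eq_empty) (auto simp: linear_0)

text \<open>Deletion and restriction turn \<open>regs_Suc\<close> into an upper bound. The factor 2
  is there because antipodal cells are counted separately.\<close>

lemma card_cells_le:
  fixes a :: "'i \<Rightarrow> 'v::real_vector \<Rightarrow> real"
  assumes lin: "\<And>i. linear (a i)"
  assumes "finite I" "I \<noteq> {}" "has_dim V D" "D \<ge> 1"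
  shows "card (cells V a I) \<le> 2 * regs (card I) D"
  using assms(2-)
proof (induction I arbitrary: V D rule: finite_ne_induct)
  case (singleton i)
  have "card (cells V a {i}) \<le> card (Pow {i})"
    by (intro card_mono) (auto simp: cells_def)
  then show ?case using singleton by (simp add: card_Pow)
next
  case (insert h I)
  have V: "subspace V" using insert.prems has_dim_subspace by blast
  show ?case
  proof (cases "\<exists>x\<in>V. a h x \<noteq> 0")
    case False
    then have "cells V a (insert h I) = {}" by (intro cells_eq_empty[of h]) auto
    then show ?thesis by simp
  next
    case True
    have *: "card (cells V a (insert h I)) = card (cells V a I) + card (cells (ker_in V (a h)) a I)"
      using card_cells_insert[of V I h a] V insert.hyps lin True by blast
    have c: "card I \<ge> 1" using insert.hyps by (simp add: Suc_leI card_gt_0_iff)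
    obtain D' where D: "D = Suc D'" using insert.prems by (cases D) auto
    have ker: "has_dim (ker_in V (a h)) D'"
      using has_dim_ker[of V D' "a h"] insert.prems True lin D by blast
    show ?thesis
    proof (cases "D' = 0")
      case True
      then have "ker_in V (a h) = {0}" using ker has_dim_0 by blast
      then have "cells (ker_in V (a h)) a I = {}"
        using cells_zero_space lin insert.hyps by (metis ex_in_conv)
      then show ?thesis
        using * insert.IH[OF insert.prems] c True D insert.hyps by simp
    next
      case False
      then have "card (cells (ker_in V (a h)) a I) \<le> 2 * regs (card I) D'"
        using insert.IH[OF ker] by simp
      then show ?thesis
        using * insert.IH[OF insert.prems] c D insert.hyps by (simp add: regs_Suc)
    qed
  qed
qed

lemma card_cells_line:
  fixes a :: "'i \<Rightarrow> 'v::real_vector \<Rightarrow> real"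
  assumes lin: "\<And>i. linear (a i)" and V: "has_dim V 1"
  assumes "finite I" "I \<noteq> {}" "\<And>i. i \<in> I \<Longrightarrow> \<exists>x\<in>V. a i x \<noteq> 0"
  shows "card (cells V a I) = 2"
  using assms(3-)
proof (induction I rule: finite_ne_induct)
  case (singleton h)
  have "0 \<in> ker_in V (a h)" using V lin by (auto simp: linear_0 subspace_0 has_dim_subspace)
  then show ?case
    using card_cells_insert[of V "{}" h a] V lin singleton has_dim_subspace
    by (fastforce simp: cells_empty_index[of 0])
next
  case (insert h I)
  have nz: "\<exists>x\<in>V. a h x \<noteq> 0" using insert.prems by blast
  then have "has_dim (ker_in V (a h)) 0"
    using has_dim_ker[of V 0 "a h"] V lin by simp
  then have "ker_in V (a h) = {0}" using has_dim_0 by blast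
  then have "cells (ker_in V (a h)) a I = {}"
    using cells_zero_space lin insert.hyps by (metis ex_in_conv)
  then show ?case
    using card_cells_insert[of V I h a] V lin insert nz has_dim_subspace by fastforce
qed

text \<open>
  Up to size \<open>D\<close> the independent sets are those of a paving matroid of rank \<open>D\<close> whose nontrivial
  hyperplanes are the sets \<open>g j\<close>; the dimension of \<open>V\<close> may exceed \<open>D\<close>.
\<close>

definition sparse_rank :: "'v::real_vector set \<Rightarrow> nat \<Rightarrow> ('i \<Rightarrow> 'v \<Rightarrow> real) \<Rightarrow> 'i set \<Rightarrow> 'j set \<Rightarrow> ('j \<Rightarrow> 'i set) \<Rightarrow> bool"
  where "sparse_rank V D a I J g \<longleftrightarrow> finite I \<and> finite J \<and> (\<forall>i. linear (a i)) \<and>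
    (\<forall>j\<in>J. g j \<subseteq> I) \<and> (\<forall>j\<in>J. \<forall>k\<in>J. j \<noteq> k \<longrightarrow> Suc (card (g j \<inter> g k)) < D) \<and>
    (\<forall>S\<subseteq>I. card S \<le> D \<longrightarrow> (indep_on V a S \<longleftrightarrow> (card S = D \<longrightarrow> (\<forall>j\<in>J. \<not> S \<subseteq> g j))))"

definition paving :: "'v::real_vector set \<Rightarrow> nat \<Rightarrow> ('i \<Rightarrow> 'v \<Rightarrow> real) \<Rightarrow> 'i set \<Rightarrow> 'j set \<Rightarrow> ('j \<Rightarrow> 'i set) \<Rightarrow> bool"
  where "paving V D a I J g \<longleftrightarrow> has_dim V D \<and> sparse_rank V D a I J g"

lemma sparse_rankD:
  assumes "sparse_rank V D a I J g"
  shows "finite I" "finite J" "linear (a i)"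
    "j \<in> J \<Longrightarrow> g j \<subseteq> I"
    "j \<in> J \<Longrightarrow> k \<in> J \<Longrightarrow> j \<noteq> k \<Longrightarrow> Suc (card (g j \<inter> g k)) < D"
    "S \<subseteq> I \<Longrightarrow> card S < D \<Longrightarrow> indep_on V a S"
    "S \<subseteq> I \<Longrightarrow> card S = D \<Longrightarrow> indep_on V a S \<longleftrightarrow> (\<forall>j\<in>J. \<not> S \<subseteq> g j)"
  using assms unfolding sparse_rank_def by auto

lemma pavingD:
  assumes "paving V D a I J g"
  shows "has_dim V D" "finite I" "finite J" "linear (a i)" "subspace V"
    "j \<in> J \<Longrightarrow> g j \<subseteq> I"
    "j \<in> J \<Longrightarrow> k \<in> J \<Longrightarrow> j \<noteq> k \<Longrightarrow> Suc (card (g j \<inter> g k)) < D"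
    "S \<subseteq> I \<Longrightarrow> card S < D \<Longrightarrow> indep_on V a S"
    "S \<subseteq> I \<Longrightarrow> card S = D \<Longrightarrow> indep_on V a S \<longleftrightarrow> (\<forall>j\<in>J. \<not> S \<subseteq> g j)"
  using assms has_dim_subspace unfolding paving_def sparse_rank_def by auto

lemma card_Int_Diff_le: "finite A \<Longrightarrow> card ((A - {h}) \<inter> (B - {h})) \<le> card (A \<inter> B)"
  by (intro card_mono) auto

lemma paving_delete:
  assumes "paving V D a (insert h I) J g" "h \<notin> I"
  shows "paving V D a I J (\<lambda>j. g j - {h})"
proof -
  note P = pavingD[OF assms(1)]
  have "Suc (card ((g j - {h}) \<inter> (g k - {h}))) < D" if "j \<in> J" "k \<in> J" "j \<noteq> k" for j k
    using P(7)[OF that] card_Int_Diff_le[of "g j" h "g k"] P(6)[OF that(1)] P(2)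
    by (meson Suc_le_mono finite_subset le_less_trans)
  moreover have "indep_on V a S \<longleftrightarrow> (card S = D \<longrightarrow> (\<forall>j\<in>J. \<not> S \<subseteq> g j - {h}))"
    if "S \<subseteq> I" "card S \<le> D" for S
  proof -
    have "S \<subseteq> g j - {h} \<longleftrightarrow> S \<subseteq> g j" for j using that assms(2) by auto
    moreover have "S \<subseteq> insert h I" using that by blast
    ultimately show ?thesis
      using that P(8)[of S] P(9)[of S] by (cases "card S = D") simp_all
  qed
  ultimately show ?thesis
    unfolding paving_def sparse_rank_def using P(1-4,6) by fastforce
qed

text \<open>A set \<open>S\<close> becomes dependent on the kernel exactly if
  \<open>insert h S\<close> was dependent, that is, lay in a group. Hence only the groups through
  \<open>h\<close> survive, each without \<open>h\<close>.\<close>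

lemma paving_contract:
  assumes pav: "paving V (Suc D) a (insert h I) J g" and "h \<notin> I" "\<exists>x\<in>V. a h x \<noteq> 0"
  shows "paving (ker_in V (a h)) D a I {j\<in>J. h \<in> g j} (\<lambda>j. g j - {h})"
proof -
  note P = pavingD[OF pav]
  have "Suc (card ((g j - {h}) \<inter> (g k - {h}))) < D"
    if "j \<in> J" "k \<in> J" "j \<noteq> k" "h \<in> g j" "h \<in> g k" for j k
  proof -
    have "finite (g j \<inter> g k)" using P(6)[OF that(1)] P(2) by (meson finite_Int finite_subset)
    moreover have "(g j - {h}) \<inter> (g k - {h}) = g j \<inter> g k - {h}" by blast
    ultimately have "card (g j \<inter> g k) = Suc (card ((g j - {h}) \<inter> (g k - {h})))"
      using that by (metis IntI card_Suc_Diff1)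
    then show ?thesis using P(7)[OF that(1-3)] by simp
  qed
  moreover have "indep_on (ker_in V (a h)) a S \<longleftrightarrow> (card S = D \<longrightarrow> (\<forall>j\<in>{j\<in>J. h \<in> g j}. \<not> S \<subseteq> g j - {h}))"
    if "S \<subseteq> I" "card S \<le> D" for S
  proof -
    have S: "h \<notin> S" "finite S" using that assms(2) P(2) by (auto intro: finite_subset)
    have "indep_on (ker_in V (a h)) a S \<longleftrightarrow> indep_on V a (insert h S)"
      using indep_on_ker[of V a h S] P(5,4) S assms(3) by blast
    moreover have "insert h S \<subseteq> insert h I" "card (insert h S) = Suc (card S)"
      using that S by auto
    moreover have "(\<forall>j\<in>{j\<in>J. h \<in> g j}. \<not> S \<subseteq> g j - {h}) \<longleftrightarrow> (\<forall>j\<in>J. \<not> insert h S \<subseteq> g j)"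
      using S by blast
    ultimately show ?thesis
      using that P(8)[of "insert h S"] P(9)[of "insert h S"] by (cases "card S = D") simp_all
  qed
  moreover have "has_dim (ker_in V (a h)) D"
    using has_dim_ker[of V D "a h"] P(1,4) assms(3) by blast
  ultimately show ?thesis
    unfolding paving_def sparse_rank_def using P(2-4,6) by fastforce
qed

text \<open>Deletion and restriction both stay within paving arrangements, and \<open>regs\<close>
  and \<open>deficit\<close> follow the Pascal recurrence of the cell count. Groups avoiding
  \<open>h\<close> pass to the deletion unchanged and disappear from the restriction.\<close>

theorem card_cells_paving:
  fixes a :: "'i \<Rightarrow> 'v::real_vector \<Rightarrow> real"
  assumes "finite I" "I \<noteq> {}" "paving V D a I J g" "D \<ge> 1"
  shows "card (cells V a I) + 2 * (\<Sum>j\<in>J. deficit (card (g j)) D) = 2 * regs (card I) D"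
proof -
  have dim1: "card (cells V a I) + 2 * (\<Sum>j\<in>J. deficit (card (g j)) 1) = 2"
    if pav: "paving V 1 a I J g" and "I \<noteq> {}" for V I and J :: "'b set" and g
  proof (cases "\<forall>i\<in>I. \<exists>x\<in>V. a i x \<noteq> 0")
    case True
    note P = pavingD[OF pav]
    have "g j = {}" if "j \<in> J" for j
    proof (rule ccontr)
      assume "g j \<noteq> {}"
      then obtain i where i: "i \<in> g j" by blast
      then have "i \<in> I" using P(6)[OF that] by blast
      then have "\<not> indep_on V a {i}" using P(9)[of "{i}"] i that by auto
      moreover have "indep_on V a {i}"
        using indep_on_insert[of V a i "{}"] P(4,5) indep_on_empty[of V a] True \<open>i \<in> I\<close> by simp
      ultimately show False by blast
    qed
    moreover have "card (cells V a I) = 2"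
      using card_cells_line[of a V I] P(1,2,4) that(2) True by blast
    ultimately show ?thesis by (simp add: deficit_def)
  next
    case False
    note P = pavingD[OF pav]
    from False obtain i where i: "i \<in> I" "\<forall>x\<in>V. a i x = 0" by blast
    then have "cells V a I = {}" by (intro cells_eq_empty[of i]) auto
    moreover have "\<not> indep_on V a {i}"
      using i unfolding indep_on_def by (auto intro!: exI[of _ "\<lambda>_. 1"])
    then obtain j where j: "j \<in> J" "i \<in> g j" using P(9)[of "{i}"] i by auto
    \<comment> \<open>A second group would violate \<open>Suc (card (g j \<inter> g k)) < 1\<close>.
      The single nonempty group has deficit 1, which accounts for both missing cells.\<close>
    moreover have "J = {j}" using P(7)[of j] j by auto
    moreover have "card (g j) \<noteq> 0"
      using j P(6)[OF j(1)] P(2) by (metis card_0_eq empty_iff finite_subset)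
    ultimately show ?thesis by (simp add: deficit_def)
  qed
  show ?thesis
    using assms
  proof (induction I arbitrary: V D J g rule: finite_ne_induct)
    case (singleton h)
    show ?case
    proof (cases "D = 1")
      case True
      then show ?thesis using dim1[of V "{h}" J g] singleton by simp
    next
      case False
      note P = pavingD[OF singleton.prems(1)]
      have "indep_on V a {h}" using P(8)[of "{h}"] False singleton by simp
      then have nz: "\<exists>x\<in>V. a h x \<noteq> 0"
        using indep_on_insert[of V a h "{}"] P(4,5) by simp
      have "0 \<in> V" "0 \<in> ker_in V (a h)" using P(4,5) by (auto simp: linear_0 subspace_0)
      then have "card (cells V a {h}) = 2"
        using card_cells_insert[of V "{}" h a] P(4,5) nz by (simp add: cells_empty_index[of 0])
      moreover have "deficit (card (g j)) D = 0" if "j \<in> J" for j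
      proof -
        have "card (g j) \<le> card {h}" using P(6)[OF that] by (intro card_mono) auto
        then show ?thesis using False singleton by (intro deficit_small) simp
      qed
      ultimately show ?thesis using singleton by simp
    qed
  next
    case (insert h I)
    note P = pavingD[OF insert.prems(1)]
    have c: "card I \<ge> 1" using insert.hyps by (simp add: Suc_leI card_gt_0_iff)
    show ?case
    proof (cases "D = 1")
      case True
      then show ?thesis using dim1[of V "insert h I" J g] insert.prems insert.hyps c by simp
    next
      case False
      then obtain D' where D: "D = Suc D'" "D' \<ge> 1" using insert.prems by (cases D) auto
      have "indep_on V a {h}" using P(8)[of "{h}"] False D by simp
      then have nz: "\<exists>x\<in>V. a h x \<noteq> 0"
        using indep_on_insert[of V a h "{}"] P(4,5) by simp
      have *: "card (cells V a (insert h I)) = card (cells V a I) + card (cells (ker_in V (a h)) a I)"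
        using card_cells_insert[of V I h a] P(4,5) insert.hyps nz by blast
      have d: "card (cells V a I) + 2 * (\<Sum>j\<in>J. deficit (card (g j - {h})) D) = 2 * regs (card I) D"
        by (rule insert.IH[OF paving_delete]) (use insert in auto)
      have r: "card (cells (ker_in V (a h)) a I) + 2 * (\<Sum>j\<in>{j\<in>J. h \<in> g j}. deficit (card (g j - {h})) D')
          = 2 * regs (card I) D'"
        by (rule insert.IH[OF paving_contract]) (use insert D nz in auto)
      have "(\<Sum>j\<in>{j\<in>J. h \<in> g j}. deficit (card (g j - {h})) D')
          = (\<Sum>j\<in>J. if h \<in> g j then deficit (card (g j - {h})) D' else 0)"
        using P(3) by (simp only: sum.inter_filter)
      then have "(\<Sum>j\<in>J. deficit (card (g j - {h})) D) + (\<Sum>j\<in>{j\<in>J. h \<in> g j}. deficit (card (g j - {h})) D')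
          = (\<Sum>j\<in>J. deficit (card (g j - {h})) D + (if h \<in> g j then deficit (card (g j - {h})) D' else 0))"
        by (simp add: sum.distrib)
      also have "\<dots> = (\<Sum>j\<in>J. deficit (card (g j)) D)"
      proof (rule sum.cong)
        fix j assume "j \<in> J"
        then have fin: "finite (g j)" using P(6) P(2) finite_subset by blast
        show "deficit (card (g j - {h})) D + (if h \<in> g j then deficit (card (g j - {h})) D' else 0)
            = deficit (card (g j)) D"
        proof (cases "h \<in> g j")
          case True
          then have "card (g j) = Suc (card (g j - {h}))" using card_Suc_Diff1[OF fin] by simp
          then show ?thesis using True D deficit_Suc[OF D(2), of "card (g j - {h})"] by simp
        qed simp
      qed simp
      finally show ?thesis
        using * d r regs_Suc[OF c, of D'] D(1) insert.hyps(1,3) by simp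
    qed
  qed
qed

section \<open>Building arrangements with prescribed incidences one form at a time\<close>

lemma ex_linear_separating:
  fixes x p :: "'v::real_vector"
  assumes "x \<notin> span {p}"
  shows "\<exists>h::'v \<Rightarrow> real. linear h \<and> h p = 0 \<and> h x = 1"
proof (cases "p = 0")
  case True
  then have "independent {x}" using assms by (auto simp: dependent_single)
  then obtain h :: "'v \<Rightarrow> real" where h: "linear h" "\<forall>y\<in>{x}. h y = 1"
    using linear_independent_extend[of "{x}" "\<lambda>_. 1"] by blast
  then show ?thesis using True by (auto simp: linear_0 intro!: exI[of _ h])
next
  case False
  then have "independent {x, p}" using assms by (simp add: independent_insertI dependent_single)
  then obtain h :: "'v \<Rightarrow> real" where h: "linear h" "\<forall>y\<in>{x, p}. h y = (if y = p then 0 else 1)"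
    using linear_independent_extend[of "{x, p}" "\<lambda>y. if y = p then 0 else 1"] by blast
  moreover have "x \<noteq> p" using assms span_base by blast
  ultimately show ?thesis by (auto intro!: exI[of _ h])
qed

text \<open>A form through \<open>p\<close> that is generic with respect to finitely many vectors: a
  small multiple of a form that is nonzero at the next vector repairs that value and spoils no
  earlier one. The choice \<open>p = 0\<close> imposes no incidence.\<close>

lemma ex_linear_avoiding:
  fixes p :: "'v::real_vector"
  assumes "finite X" "\<And>x. x \<in> X \<Longrightarrow> x \<notin> span {p}"
  shows "\<exists>h::'v \<Rightarrow> real. linear h \<and> h p = 0 \<and> (\<forall>x\<in>X. h x \<noteq> 0)"
  using assms
proof (induction X)
  case empty
  show ?case by (intro exI[of _ "\<lambda>_. 0"]) (auto intro: linear_zero)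
next
  case (insert x X)
  then obtain h :: "'v \<Rightarrow> real" where h: "linear h" "h p = 0" "\<forall>x\<in>X. h x \<noteq> 0" by auto
  obtain k :: "'v \<Rightarrow> real" where k: "linear k" "k p = 0" "k x = 1"
    using ex_linear_separating[of x p] insert.prems by blast
  show ?case
  proof (cases "h x = 0")
    case True
    obtain t where t: "t > 0" "\<forall>y\<in>X. (h y > 0 \<longrightarrow> h y + t * k y > 0 \<and> h y - t * k y > 0)
                   \<and> (h y < 0 \<longrightarrow> h y + t * k y < 0 \<and> h y - t * k y < 0)"
      using small_perturbation[OF insert.hyps(1), of h k] by blast
    have "linear (\<lambda>y. h y + t * k y)"
      using h(1) k(1) by (auto intro!: linear_compose_add linear_compose_scale_right simp flip: real_scaleR_def)
    moreover have "h y + t * k y \<noteq> 0" if "y \<in> insert x X" for y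
      using that t h(3) True k(3) by (metis insertE less_irrefl linorder_neqE_linordered_idom mult.right_neutral add_0)
    ultimately show ?thesis
      using h k by (intro exI[of _ "\<lambda>y. h y + t * k y"]) simp
  qed (use h in auto)
qed

text \<open>Any \<open>D\<close> forms of the group are independent and have a line of common zeros
  in dimension \<open>Suc D\<close>. Each further form of the group depends on them, so it vanishes
  on this line: the group passes through a projective point.\<close>

lemma paving_group_zero:
  assumes pav: "paving V (Suc D) a I J g" and "j \<in> J" "card (g j) \<ge> D"
  obtains p G where "p \<in> V" "p \<noteq> 0" "\<And>i. i \<in> g j \<Longrightarrow> a i p = 0" "G \<subseteq> g j" "card G = D"
proof -
  note P = pavingD[OF pav]
  obtain G where G: "G \<subseteq> g j" "card G = D" using assms(3) obtain_subset_with_card_n by metis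
  have GI: "G \<subseteq> I" "finite G" using G P(6)[OF assms(2)] P(2) by (auto intro: finite_subset)
  have "indep_on V a G" using P(8)[of G] G GI by simp
  then have "has_dim {x\<in>V. \<forall>i\<in>G. a i x = 0} (Suc D - card G)"
    using has_dim_common_zeros[of a G V "Suc D"] P(1,4) GI by blast
  then obtain p where p: "p \<in> {x\<in>V. \<forall>i\<in>G. a i x = 0}" "p \<noteq> 0"
    using has_dim_nonzero[of "{x\<in>V. \<forall>i\<in>G. a i x = 0}" "Suc D - card G"] G by auto
  have "a i p = 0" if "i \<in> g j" for i
  proof (cases "i \<in> G")
    case False
    have "insert i G \<subseteq> g j" "card (insert i G) = Suc D" using False G GI that by auto
    then have "\<not> indep_on V a (insert i G)"
      using P(9)[of "insert i G"] P(6)[OF assms(2)] assms(2) by blast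
    then show ?thesis
      using indep_on_insert[of V a i G] P(4,5) False \<open>indep_on V a G\<close> p by blast
  qed (use p in blast)
  then show ?thesis using that p G by blast
qed

text \<open>The new form must vanish at the point \<open>p\<close> of its group, if that group
  already determines one, and must not vanish identically on the common zeros of any small set
  outside the group. Since \<open>card T \<le> 1\<close>, only one such point occurs.\<close>

theorem paving_extend:
  fixes a :: "'i \<Rightarrow> 'v::real_vector \<Rightarrow> real"
  assumes pav: "paving V D a I J g" and "i \<notin> I" "D \<ge> 1" and T: "T \<subseteq> J" "card T \<le> 1"
  shows "\<exists>h. paving V D (a(i := h)) (insert i I) J (\<lambda>j. if j \<in> T then insert i (g j) else g j)"
proof -
  note P = pavingD[OF pav]
  obtain E where D: "D = Suc E" using assms(3) by (cases D) auto
  have T': "j = k" if "j \<in> T" "k \<in> T" for j k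
    using T that P(3) by (metis One_nat_def card_le_Suc0_iff_eq finite_subset)
  \<comment> \<open>The bad sets are those that the new form must complete to a dependent set of
    size \<open>D\<close>. Every other set of at most \<open>E\<close> forms must stay independent
    when the new form joins it.\<close>
  define bad where "bad S \<longleftrightarrow> card S = E \<and> (\<exists>j\<in>T. S \<subseteq> g j)" for S
  define \<S> where "\<S> = {S. S \<subseteq> I \<and> card S \<le> E \<and> \<not> bad S}"
  have fin: "finite S" if "S \<subseteq> I" for S using that P(2) finite_subset by blast
  have dimS: "has_dim {x\<in>V. \<forall>k\<in>S. a k x = 0} (D - card S)" if "S \<subseteq> I" "card S \<le> E" for S
    using has_dim_common_zeros[of a S V D] P(1,4) P(8)[of S] fin[of S] that D by simp
  obtain p where p: "\<And>S. S \<in> \<S> \<Longrightarrow> \<exists>x\<in>V. (\<forall>k\<in>S. a k x = 0) \<and> x \<notin> span {p}"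
    "\<And>S x. S \<subseteq> I \<Longrightarrow> bad S \<Longrightarrow> x \<in> V \<Longrightarrow> (\<And>k. k \<in> S \<Longrightarrow> a k x = 0) \<Longrightarrow> x \<in> span {p}"
  proof (cases "\<exists>j\<in>T. card (g j) \<ge> E")
    case False
    have nb: "\<not> bad S" if "S \<subseteq> I" for S
    proof
      assume "bad S"
      then obtain j where j: "j \<in> T" "S \<subseteq> g j" "card S = E" by (auto simp: bad_def)
      then have "E \<le> card (g j)" using T P(6) fin by (metis card_mono subsetD)
      then show False using False j by blast
    qed
    show ?thesis
    \<comment> \<open>The group still has fewer than \<open>E\<close> members, so it determines no
      point and the new form may be fully generic.\<close>
    proof (rule that[of 0])
      fix S assume "S \<in> \<S>"
      then have "has_dim {x\<in>V. \<forall>k\<in>S. a k x = 0} (D - card S)" "1 \<le> D - card S"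
        using dimS D by (auto simp: \<S>_def)
      then show "\<exists>x\<in>V. (\<forall>k\<in>S. a k x = 0) \<and> x \<notin> span {0}"
        using has_dim_nonzero by fastforce
    qed (use nb in blast)
  next
    case True
    then obtain j where j: "j \<in> T" "card (g j) \<ge> E" by blast
    then have jJ: "j \<in> J" using T by blast
    obtain p G where p: "p \<in> V" "p \<noteq> 0" "\<And>i. i \<in> g j \<Longrightarrow> a i p = 0" "G \<subseteq> g j" "card G = E"
      using paving_group_zero[OF pav[unfolded D] jJ j(2)] by blast
    show ?thesis
    proof (rule that[of p])
      fix S assume S: "S \<in> \<S>"
      then have dS: "has_dim {x\<in>V. \<forall>k\<in>S. a k x = 0} (D - card S)" and SI: "S \<subseteq> I" "card S \<le> E"
        using dimS D by (auto simp: \<S>_def)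
      show "\<exists>x\<in>V. (\<forall>k\<in>S. a k x = 0) \<and> x \<notin> span {p}"
      proof (cases "card S = E")
        case False
        then have "2 \<le> D - card S" using SI D by simp
        from has_dim_outside_line[OF dS this, of p] show ?thesis by blast
      next
        case True
        then have "\<not> S \<subseteq> g j" using S j by (auto simp: \<S>_def bad_def)
        then obtain s where s: "s \<in> S" "s \<notin> g j" by blast
        obtain x where x: "x \<in> V" "\<forall>k\<in>S. a k x = 0" "x \<noteq> 0"
          using has_dim_nonzero[OF dS] True D by auto
        moreover have "x \<notin> span {p}"
        proof
          assume "x \<in> span {p}"
          then obtain c where c: "x = c *\<^sub>R p" by (auto simp: span_singleton)
          then have "c \<noteq> 0" using x by auto
          moreover have "a s x = c * a s p" unfolding c using P(4)[of s] by (simp add: linear_scale)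
          ultimately have "a s p = 0" using x s by auto
          then have pz: "a k p = 0" if "k \<in> insert s G" for k using that p by auto
          have GI: "G \<subseteq> I" "finite G" "s \<notin> G" "s \<in> I"
            using p s SI P(6)[OF jJ] fin by blast+
          then have "insert s G \<subseteq> I" "card (insert s G) = D" using D p by auto
          \<comment> \<open>A nonzero common zero \<open>p\<close> of these \<open>D\<close> forms
            makes them dependent, so they lie in some group \<open>k\<close>. It differs from
            \<open>j\<close> because of \<open>s\<close>, yet shares the \<open>D - 1\<close> forms
            of \<open>G\<close> with it, which is too many.\<close>
          moreover have "\<not> indep_on V a (insert s G)"
          proof
            assume "indep_on V a (insert s G)"
            then have "has_dim {x\<in>V. \<forall>k\<in>insert s G. a k x = 0} 0"
              using has_dim_common_zeros[of a "insert s G" V D] P(1,4) GI \<open>card (insert s G) = D\<close>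
              by fastforce
            then have "p \<in> {0}" using has_dim_0 p(1) pz by blast
            then show False using p by simp
          qed
          ultimately obtain k where k: "k \<in> J" "insert s G \<subseteq> g k" using P(9) by blast
          then have "k \<noteq> j" using s by blast
          then have "Suc (card (g j \<inter> g k)) < D" using P(7) jJ k by blast
          moreover have "card G \<le> card (g j \<inter> g k)"
            using k p P(6)[OF jJ] fin by (intro card_mono) auto
          ultimately show False using p D by simp
        qed
        ultimately show ?thesis by blast
      qed
    next
      fix S x assume S: "S \<subseteq> I" "bad S" and x: "x \<in> V" "\<And>k. k \<in> S \<Longrightarrow> a k x = 0"
      then have Sj: "S \<subseteq> g j" "card S = E" using T' j unfolding bad_def by blast+
      then have "has_dim {x\<in>V. \<forall>k\<in>S. a k x = 0} 1" using dimS[of S] S D by simp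
      then obtain b where b: "\<And>y. y \<in> {x\<in>V. \<forall>k\<in>S. a k x = 0} \<Longrightarrow> \<exists>c. y = c *\<^sub>R b"
        using has_dim_1 by blast
      obtain c where c: "x = c *\<^sub>R b" using b[of x] x by blast
      obtain e where e: "p = e *\<^sub>R b" using b[of p] p Sj by blast
      then have "x = (c / e) *\<^sub>R p" using p c by auto
      then show "x \<in> span {p}" by (auto simp: span_singleton)
    qed
  qed
  have "\<forall>S\<in>\<S>. \<exists>x. x \<in> V \<and> (\<forall>k\<in>S. a k x = 0) \<and> x \<notin> span {p}"
    using p(1) by blast
  from bchoice[OF this] obtain xs
    where xs: "\<forall>S\<in>\<S>. xs S \<in> V \<and> (\<forall>k\<in>S. a k (xs S) = 0) \<and> xs S \<notin> span {p}" ..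
  have "finite \<S>" unfolding \<S>_def using P(2) by (auto intro: finite_subset[of _ "Pow I"])
  then have "finite (xs ` \<S>)" "\<And>x. x \<in> xs ` \<S> \<Longrightarrow> x \<notin> span {p}"
    using xs by auto
  from ex_linear_avoiding[OF this] obtain h :: "'v \<Rightarrow> real"
    where h: "linear h" "h p = 0" "\<And>S. S \<in> \<S> \<Longrightarrow> h (xs S) \<noteq> 0"
    by auto
  define b where "b = a(i := h)"
  define g' where "g' = (\<lambda>j. if j \<in> T then insert i (g j) else g j)"
  have lin: "linear (b k)" for k using h P(4) by (simp add: b_def)
  have gI: "i \<notin> g j" "g j \<subseteq> I" if "j \<in> J" for j using P(6)[OF that] assms(2) by auto
  have "Suc (card (g' j \<inter> g' k)) < D" if "j \<in> J" "k \<in> J" "j \<noteq> k" for j k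
  proof -
    have "g' j \<inter> g' k = g j \<inter> g k"
      using gI that T' unfolding g'_def by auto
    then show ?thesis using P(7) that by simp
  qed
  moreover have "indep_on V b S \<longleftrightarrow> (card S = D \<longrightarrow> (\<forall>j\<in>J. \<not> S \<subseteq> g' j))"
    if S: "S \<subseteq> insert i I" "card S \<le> D" for S
  proof (cases "i \<in> S")
    case False
    then have SI: "S \<subseteq> I" using S by blast
    have "indep_on V b S \<longleftrightarrow> indep_on V a S"
      using False by (intro indep_on_cong) (auto simp: b_def)
    moreover have "S \<subseteq> g' j \<longleftrightarrow> S \<subseteq> g j" for j using False by (auto simp: g'_def)
    ultimately show ?thesis
      using P(8)[OF SI] P(9)[OF SI] S by (cases "card S = D") simp_all
  next
    case True
    define R where "R = S - {i}"
    have R: "S = insert i R" "i \<notin> R" "R \<subseteq> I" using True S by (auto simp: R_def)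
    then have cS: "card S = Suc (card R)" using fin by simp
    have "indep_on V b R \<longleftrightarrow> indep_on V a R"
      using R by (intro indep_on_cong) (auto simp: b_def)
    then have "indep_on V b R" using P(8)[OF R(3)] cS S by simp
    moreover have bk: "b k = a k" if "k \<in> R" for k using that R by (auto simp: b_def)
    moreover have "b i = h" by (simp add: b_def)
    ultimately have *: "indep_on V b S \<longleftrightarrow> (\<exists>x\<in>V. (\<forall>k\<in>R. a k x = 0) \<and> h x \<noteq> 0)"
      using indep_on_insert[of V b i R] P(5) lin R by simp
    show ?thesis
    proof (cases "bad R")
      case True
      then obtain j where "j \<in> T" "R \<subseteq> g j" "card R = E" by (auto simp: bad_def)
      then have "card S = D" "j \<in> J" "S \<subseteq> g' j" using T R cS D by (auto simp: g'_def)
      moreover have "h x = 0" if "x \<in> V" "\<forall>k\<in>R. a k x = 0" for x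
      proof -
        have "x \<in> span {p}" using p(2)[OF R(3) True] that by blast
        then obtain c where "x = c *\<^sub>R p" by (auto simp: span_singleton)
        then show ?thesis using h by (simp add: linear_scale)
      qed
      ultimately show ?thesis using * by blast
    next
      case False
      then have "R \<in> \<S>" using R S cS D by (simp add: \<S>_def)
      then have "indep_on V b S" using * xs h by blast
      moreover have "\<not> S \<subseteq> g' j" if "card S = D" "j \<in> J" for j
      proof
        assume "S \<subseteq> g' j"
        then have "j \<in> T" using R gI[OF that(2)] by (auto simp: g'_def split: if_splits)
        moreover have "R \<subseteq> g j" using \<open>S \<subseteq> g' j\<close> R by (auto simp: g'_def split: if_splits)
        ultimately show False using False that cS D by (auto simp: bad_def)
      qed
      ultimately show ?thesis by blast
    qed
  qed
  moreover have "g' j \<subseteq> insert i I" if "j \<in> J" for j using gI[OF that] by (auto simp: g'_def)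
  ultimately have "paving V D b (insert i I) J g'"
    unfolding paving_def sparse_rank_def using P(1-3) lin by blast
  then show ?thesis unfolding b_def g'_def by blast
qed

text \<open>Cells depend only on the set of value vectors that are attained. Thus a noninjective
  projection from \<open>V\<close> onto \<open>W\<close> is as good as an isomorphism; the next
  lemma says the same of independence.\<close>

lemma cells_transfer:
  assumes "\<And>x. x \<in> V \<Longrightarrow> \<exists>y\<in>W. \<forall>i\<in>I. b i x = a i y"
    and "\<And>y. y \<in> W \<Longrightarrow> \<exists>x\<in>V. \<forall>i\<in>I. b i x = a i y"
  shows "cells V b I = cells W a I"
proof -
  have "(\<exists>x\<in>V. (\<forall>i\<in>J. b i x > 0) \<and> (\<forall>i\<in>I - J. b i x < 0)) \<longleftrightarrow>
      (\<exists>x\<in>W. (\<forall>i\<in>J. a i x > 0) \<and> (\<forall>i\<in>I - J. a i x < 0))" if J: "J \<subseteq> I" for J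
  proof
    assume "\<exists>x\<in>V. (\<forall>i\<in>J. b i x > 0) \<and> (\<forall>i\<in>I - J. b i x < 0)"
    then obtain x where x: "x \<in> V" "(\<forall>i\<in>J. b i x > 0) \<and> (\<forall>i\<in>I - J. b i x < 0)" by blast
    then obtain y where "y \<in> W" "\<forall>i\<in>I. b i x = a i y" using assms(1) by blast
    with x J show "\<exists>x\<in>W. (\<forall>i\<in>J. a i x > 0) \<and> (\<forall>i\<in>I - J. a i x < 0)"
      by (intro bexI[of _ y]) (auto simp: subset_iff)
  next
    assume "\<exists>x\<in>W. (\<forall>i\<in>J. a i x > 0) \<and> (\<forall>i\<in>I - J. a i x < 0)"
    then obtain y where y: "y \<in> W" "(\<forall>i\<in>J. a i y > 0) \<and> (\<forall>i\<in>I - J. a i y < 0)" by blast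
    then obtain x where "x \<in> V" "\<forall>i\<in>I. b i x = a i y" using assms(2) by blast
    with y J show "\<exists>x\<in>V. (\<forall>i\<in>J. b i x > 0) \<and> (\<forall>i\<in>I - J. b i x < 0)"
      by (intro bexI[of _ x]) (auto simp: subset_iff)
  qed
  then show ?thesis unfolding cells_def by blast
qed

lemma indep_on_transfer:
  assumes "\<And>x. x \<in> V \<Longrightarrow> \<exists>y\<in>W. \<forall>i\<in>S. b i x = a i y"
    and "\<And>y. y \<in> W \<Longrightarrow> \<exists>x\<in>V. \<forall>i\<in>S. b i x = a i y"
  shows "indep_on V b S \<longleftrightarrow> indep_on W a S"
  unfolding indep_on_def
proof (intro all_cong1 iffI)
  fix c
  assume "\<exists>x\<in>V. \<forall>i\<in>S. b i x = c i"
  then obtain x where x: "x \<in> V" "\<forall>i\<in>S. b i x = c i" by blast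
  then obtain y where "y \<in> W" "\<forall>i\<in>S. b i x = a i y" using assms(1) by blast
  with x show "\<exists>x\<in>W. \<forall>i\<in>S. a i x = c i" by (intro bexI[of _ y]) auto
next
  fix c
  assume "\<exists>x\<in>W. \<forall>i\<in>S. a i x = c i"
  then obtain y where y: "y \<in> W" "\<forall>i\<in>S. a i y = c i" by blast
  then obtain x where "x \<in> V" "\<forall>i\<in>S. b i x = a i y" using assms(2) by blast
  with y show "\<exists>x\<in>V. \<forall>i\<in>S. b i x = c i" by (intro bexI[of _ x]) auto
qed

lemma ex_linear_nonzero:
  fixes V :: "'v::real_vector set"
  assumes "has_dim V (Suc D)"
  shows "\<exists>h::'v \<Rightarrow> real. linear h \<and> (\<exists>x\<in>V. h x = 1)"
proof -
  obtain x where "x \<in> V" "x \<noteq> 0" using has_dim_nonzero[OF assms] by auto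
  then show ?thesis using ex_linear_separating[of x 0] by auto
qed

text \<open>Forms are added in the order of their indices. Index 0, the only one that groups may
  share, is the start; every later index lies in at most one group, as \<open>paving_extend\<close>
  requires. For \<open>D \<ge> 3\<close> a common member is a permitted overlap.\<close>

theorem paving_exists:
  fixes V :: "'v::real_vector set" and g :: "'j \<Rightarrow> nat set"
  assumes V: "has_dim V D" and D: "D \<ge> 3" and J: "finite J"
    and g: "\<And>j k. j \<in> J \<Longrightarrow> k \<in> J \<Longrightarrow> j \<noteq> k \<Longrightarrow> g j \<inter> g k \<subseteq> {0}"
  shows "\<exists>a. paving V D a {..n} J (\<lambda>j. g j \<inter> {..n})"
proof (induction n)
  case 0
  obtain D' where D': "D = Suc D'" using D by (cases D) auto
  obtain h :: "'v \<Rightarrow> real" where h: "linear h" "\<exists>x\<in>V. h x = 1"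
    using ex_linear_nonzero V D' by blast
  have sV: "subspace V" using V has_dim_subspace by blast
  have "indep_on V (\<lambda>_. h) {0}"
    using indep_on_insert[of V "\<lambda>_. h" 0 "{}"] sV h indep_on_empty[OF sV]
    by (metis empty_iff zero_neq_one)
  then have "indep_on V (\<lambda>_. h) S" "card S \<noteq> D" if "S \<subseteq> {..0}" for S :: "nat set"
    using that indep_on_mono[of V "\<lambda>_. h" "{0}" S] D card_mono[of "{..0}" S] by auto
  moreover have "Suc (card (g j \<inter> {..0} \<inter> (g k \<inter> {..0}))) < D" for j k
  proof -
    have "card (g j \<inter> {..0} \<inter> (g k \<inter> {..0})) \<le> card {0::nat}" by (intro card_mono) auto
    then show ?thesis using D by simp
  qed
  ultimately have "paving V D (\<lambda>_. h) {..0} J (\<lambda>j. g j \<inter> {..0})"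
    unfolding paving_def sparse_rank_def using V J h by auto
  then show ?case by blast
next
  case (Suc n)
  then obtain a where pav: "paving V D a {..n} J (\<lambda>j. g j \<inter> {..n})" by blast
  define T where "T = {j\<in>J. Suc n \<in> g j}"
  have "card T \<le> 1"
    using g J unfolding T_def One_nat_def by (subst card_le_Suc0_iff_eq) auto
  then obtain h where h: "paving V D (a(Suc n := h)) (insert (Suc n) {..n}) J
      (\<lambda>j. if j \<in> T then insert (Suc n) (g j \<inter> {..n}) else g j \<inter> {..n})"
    using paving_extend[OF pav, of "Suc n" T] D by (auto simp: T_def)
  have "paving V D (a(Suc n := h)) {..Suc n} J (\<lambda>j. g j \<inter> {..Suc n})"
  proof -
    have "(if j \<in> T then insert (Suc n) (g j \<inter> {..n}) else g j \<inter> {..n}) = g j \<inter> {..Suc n}"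
      if "j \<in> J" for j
      using that by (auto simp: T_def atMost_Suc)
    then show ?thesis
      using h unfolding paving_def sparse_rank_def by (simp add: atMost_Suc cong: ball_cong)
  qed
  then show ?case by blast
qed

section \<open>The first family: disjoint groups through points\<close>

definition block :: "nat list \<Rightarrow> nat \<Rightarrow> nat set" where
  "block ks j = {sum_list (take j ks)<..sum_list (take (Suc j) ks)}"

lemma sum_list_take_mono: "j \<le> k \<Longrightarrow> sum_list (take j ks) \<le> sum_list (take k (ks :: nat list))"
  by (metis le_add1 min.absorb1 sum_list_append take_add take_take le_add_diff_inverse)

lemma block_disjoint: "j \<noteq> k \<Longrightarrow> block ks j \<inter> block ks k = {}"
proof (induction j k rule: linorder_wlog)
  case (le j k)
  then have "sum_list (take (Suc j) ks) \<le> sum_list (take k ks)"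
    by (intro sum_list_take_mono) simp
  then show ?case by (auto simp: block_def)
qed blast

lemma card_block: "j < length ks \<Longrightarrow> card (block ks j) = ks ! j"
  by (simp add: block_def take_Suc_conv_app_nth)

lemma block_subset: "block ks j \<subseteq> {1..sum_list ks}"
proof -
  have "sum_list (take (Suc j) ks) \<le> sum_list ks"
    using sum_list_take_mono[of "Suc j" "max (Suc j) (length ks)" ks] by simp
  then show ?thesis by (auto simp: block_def)
qed

text \<open>Pairwise independence will make the hyperplanes distinct.\<close>

lemma sparse_rank_pairs:
  assumes "sparse_rank V D a I J g" "D \<ge> 3" "i \<in> I" "j \<in> I"
  shows "indep_on V a {i, j}"
proof -
  have "card {i, j} \<le> 2" by (simp add: card_insert_le_m1)
  then show ?thesis using sparse_rankD(6)[OF assms(1), of "{i, j}"] assms(2-) by simp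
qed

text \<open>The groups are consecutive blocks of indices that start at 1, so \<open>n + 1\<close>
  forms carry groups of total size up to \<open>n\<close>, and form 0 belongs to none.\<close>

theorem arrangement_with_disjoint_points:
  fixes V :: "'v::real_vector set"
  assumes V: "has_dim V D" and D: "D \<ge> 3" and ks: "sum_list ks \<le> n"
  shows "\<exists>a :: nat \<Rightarrow> 'v \<Rightarrow> real. (\<forall>i. linear (a i)) \<and> (\<forall>i\<le>n. \<forall>j\<le>n. indep_on V a {i, j}) \<and>
    card (cells V a {..n}) + 2 * (\<Sum>k\<leftarrow>ks. deficit k D) = 2 * regs (Suc n) D"
proof -
  define J where "J = {..<length ks}"
  obtain a :: "nat \<Rightarrow> 'v \<Rightarrow> real" where pav: "paving V D a {..n} J (\<lambda>j. block ks j \<inter> {..n})"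
    using paving_exists[OF V D, of J "block ks" n] block_disjoint by (auto simp: J_def)
  have "block ks j \<inter> {..n} = block ks j" for j using block_subset[of ks j] ks by fastforce
  then have "(\<Sum>j\<in>J. deficit (card (block ks j \<inter> {..n})) D) = (\<Sum>j\<in>J. deficit (ks ! j) D)"
    by (simp add: J_def card_block)
  also have "\<dots> = (\<Sum>k\<leftarrow>ks. deficit k D)"
    by (simp add: J_def sum_list_sum_nth atLeast0LessThan)
  finally show ?thesis
    using card_cells_paving[OF _ _ pav] pavingD(4)[OF pav] D
      sparse_rank_pairs[of V D a "{..n}" J "\<lambda>j. block ks j \<inter> {..n}"] pav[unfolded paving_def]
    by (intro exI[of _ a]) simp
qed

section \<open>The second family: cones and generic forms\<close>

text \<open>Here the dimension exceeds the rank described by one. On the kernel of a generic form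
  the old forms become a paving arrangement of rank \<open>D\<close> with the same groups, and
  \<open>card_cells_paving\<close> counts the cells gained.\<close>

lemma sparse_rank_generic_extend:
  fixes b :: "'i \<Rightarrow> 'v::real_vector \<Rightarrow> real"
  assumes V: "has_dim V (Suc D)" and sp: "sparse_rank V D b I J g" and "I \<noteq> {}" "i \<notin> I" "D \<ge> 1"
  shows "\<exists>h. sparse_rank V D (b(i := h)) (insert i I) J g \<and>
    card (cells V (b(i := h)) (insert i I)) + 2 * (\<Sum>j\<in>J. deficit (card (g j)) D)
      = card (cells V b I) + 2 * regs (card I) D"
proof -
  note P = sparse_rankD[OF sp]
  have sV: "subspace V" using V has_dim_subspace by blast
  \<comment> \<open>Independent sets of full size \<open>D\<close> are included: they have a line of
    common zeros, and they remain independent on the kernel only if the new form does not vanish on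
    that line.\<close>
  define \<S> where "\<S> = {S. S \<subseteq> I \<and> card S \<le> D \<and> indep_on V b S}"
  have "finite \<S>" unfolding \<S>_def using P(1) by (auto intro: finite_subset[of _ "Pow I"])
  have "\<exists>x. x \<in> V \<and> (\<forall>k\<in>S. b k x = 0) \<and> x \<notin> span {0}" if "S \<in> \<S>" for S
  proof -
    have S: "finite S" "card S \<le> D" "indep_on V b S"
      using that P(1) finite_subset by (auto simp: \<S>_def)
    then have "has_dim {x\<in>V. \<forall>k\<in>S. b k x = 0} (Suc D - card S)"
      using has_dim_common_zeros[of b S V "Suc D"] P(3) V by blast
    then show ?thesis using has_dim_nonzero[of "{x\<in>V. \<forall>k\<in>S. b k x = 0}"] S by fastforce
  qed
  then have "\<forall>S\<in>\<S>. \<exists>x. x \<in> V \<and> (\<forall>k\<in>S. b k x = 0) \<and> x \<notin> span {0}" by blast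
  from bchoice[OF this] obtain xs
    where xs: "\<forall>S\<in>\<S>. xs S \<in> V \<and> (\<forall>k\<in>S. b k (xs S) = 0) \<and> xs S \<notin> span {0}" ..
  then have "finite (xs ` \<S>)" "\<And>x. x \<in> xs ` \<S> \<Longrightarrow> x \<notin> span {0}"
    using \<open>finite \<S>\<close> by blast+
  from ex_linear_avoiding[OF this] obtain h :: "'v \<Rightarrow> real"
    where h: "linear h" "\<And>S. S \<in> \<S> \<Longrightarrow> h (xs S) \<noteq> 0"
    by auto
  define c where "c = b(i := h)"
  have lin: "linear (c k)" for k using h P(3) by (simp add: c_def)
  have ci: "c i = h" and cb: "\<And>k. k \<in> I \<Longrightarrow> c k = b k" using \<open>i \<notin> I\<close> by (auto simp: c_def)
  have same: "indep_on V c S \<longleftrightarrow> indep_on V b S" if "S \<subseteq> I" for S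
    using that cb by (intro indep_on_cong) auto
  have ins: "indep_on V c (insert i S)" if "S \<subseteq> I" "card S \<le> D" "indep_on V b S" for S
  proof -
    have "S \<in> \<S>" using that by (simp add: \<S>_def)
    then have "xs S \<in> V" "\<forall>k\<in>S. c k (xs S) = 0" "c i (xs S) \<noteq> 0"
      using xs h(2) cb that(1) by (auto simp: ci subset_iff)
    then show ?thesis
      using indep_on_insert[of V c i S] sV lin that \<open>i \<notin> I\<close> same by blast
  qed
  have "{} \<in> \<S>" using indep_on_empty[OF sV] by (simp add: \<S>_def)
  then have nz: "\<exists>x\<in>V. c i x \<noteq> 0" using xs h(2) ci by metis
  have rank: "indep_on V c S \<longleftrightarrow> (card S = D \<longrightarrow> (\<forall>j\<in>J. \<not> S \<subseteq> g j))"
    if S: "S \<subseteq> insert i I" "card S \<le> D" for S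
  proof (cases "i \<in> S")
    case False
    then have "S \<subseteq> I" using S by blast
    then show ?thesis using same P(6,7) S by (cases "card S = D") auto
  next
    case True
    define R where "R = S - {i}"
    have R: "S = insert i R" "i \<notin> R" "R \<subseteq> I" using True S by (auto simp: R_def)
    then have "card S = Suc (card R)" using P(1) finite_subset by (metis card_insert_disjoint)
    then have "card R < D" using S by simp
    then have "indep_on V c S" unfolding R(1) using ins[OF R(3)] P(6)[OF R(3)] by simp
    moreover have "\<not> S \<subseteq> g j" if "j \<in> J" for j using True P(4)[OF that] \<open>i \<notin> I\<close> by blast
    ultimately show ?thesis by blast
  qed
  have "sparse_rank V D c (insert i I) J g"
    unfolding sparse_rank_def using P(1,2,5) lin rank P(4) by (simp add: subset_insertI2)
  moreover have "paving (ker_in V (c i)) D c I J g"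
  proof -
    have "indep_on (ker_in V (c i)) c S \<longleftrightarrow> (card S = D \<longrightarrow> (\<forall>j\<in>J. \<not> S \<subseteq> g j))"
      if S: "S \<subseteq> I" "card S \<le> D" for S
    proof -
      have "indep_on (ker_in V (c i)) c S \<longleftrightarrow> indep_on V c (insert i S)"
        using indep_on_ker[of V c i S] sV lin nz S \<open>i \<notin> I\<close> by blast
      also have "\<dots> \<longleftrightarrow> indep_on V c S"
        using ins[OF S] same[OF S(1)] indep_on_mono[of V c "insert i S" S] by blast
      finally show ?thesis using rank[of S] S by blast
    qed
    moreover have "has_dim (ker_in V (c i)) D" using has_dim_ker[OF V lin nz] .
    ultimately show ?thesis
      unfolding paving_def sparse_rank_def using P(1,2,4,5) lin by simp
  qed
  then have "card (cells (ker_in V (c i)) c I) + 2 * (\<Sum>j\<in>J. deficit (card (g j)) D) = 2 * regs (card I) D"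
    using card_cells_paving P(1) \<open>I \<noteq> {}\<close> \<open>D \<ge> 1\<close> by blast
  moreover have "card (cells V c (insert i I)) = card (cells V c I) + card (cells (ker_in V (c i)) c I)"
    using card_cells_insert[of V I i c] sV P(1) \<open>i \<notin> I\<close> lin nz by blast
  moreover have "cells V c I = cells V b I" using cb by (intro cells_cong) simp
  ultimately show ?thesis unfolding c_def by (intro exI[of _ h]) simp
qed

text \<open>Each of the \<open>r\<close> new forms pays the deficits of all groups once more; the
  gains \<open>regs (n + i) D\<close> telescope by \<open>regs_Suc\<close>.\<close>

lemma sparse_rank_generic_extend_many:
  fixes b :: "nat \<Rightarrow> 'v::real_vector \<Rightarrow> real"
  assumes V: "has_dim V (Suc D)" and sp: "sparse_rank V D b {..<n} J g" and "n \<ge> 1" "D \<ge> 1"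
  shows "\<exists>c. sparse_rank V D c {..<n + r} J g \<and>
    card (cells V c {..<n + r}) + 2 * (r * (\<Sum>j\<in>J. deficit (card (g j)) D)) + 2 * regs n (Suc D)
      = card (cells V b {..<n}) + 2 * regs (n + r) (Suc D)"
proof (induction r)
  case 0
  then show ?case using sp by auto
next
  case (Suc r)
  then obtain c where c: "sparse_rank V D c {..<n + r} J g"
    "card (cells V c {..<n + r}) + 2 * (r * (\<Sum>j\<in>J. deficit (card (g j)) D)) + 2 * regs n (Suc D)
      = card (cells V b {..<n}) + 2 * regs (n + r) (Suc D)" by blast
  have "{..<n + r} \<noteq> {}" using \<open>n \<ge> 1\<close> by (auto simp: lessThan_empty_iff)
  then obtain h where h: "sparse_rank V D (c(n + r := h)) (insert (n + r) {..<n + r}) J g"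
    "card (cells V (c(n + r := h)) (insert (n + r) {..<n + r})) + 2 * (\<Sum>j\<in>J. deficit (card (g j)) D)
      = card (cells V c {..<n + r}) + 2 * regs (n + r) D"
    using sparse_rank_generic_extend[OF V c(1), of "n + r"] \<open>D \<ge> 1\<close> by auto
  have "insert (n + r) {..<n + r} = {..<n + Suc r}" by auto
  with h c(2) have "sparse_rank V D (c(n + r := h)) {..<n + Suc r} J g"
    "card (cells V (c(n + r := h)) {..<n + Suc r}) + 2 * (Suc r * (\<Sum>j\<in>J. deficit (card (g j)) D))
      + 2 * regs n (Suc D) = card (cells V b {..<n}) + 2 * regs (n + Suc r) (Suc D)"
    using regs_Suc[of "n + r" D] \<open>n \<ge> 1\<close> by (simp_all del: fun_upd_apply)
  then show ?case by blast
qed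

lemma sum_append_block:
  fixes f :: "nat \<Rightarrow> nat"
  shows "(\<Sum>j<length xs + s. if j < length xs then f j else c) = (\<Sum>j<length xs. f j) + s * c"
  by (induction s) auto

text \<open>The deficits of \<open>ks\<close> are counted \<open>m + 1\<close> times: in the cone
  over \<open>W\<close>, in the restrictions to the first two outside hyperplanes and in those to
  the \<open>m - 2\<close> generic ones. The second restriction also contains form 0 and alone pays
  for the \<open>s\<close> vertices.\<close>

theorem cone_arrangement:
  fixes V :: "'v::real_vector set"
  assumes V: "has_dim V (Suc D)" and D: "D \<ge> 3" and "N \<ge> 1" "m \<ge> 2"
    and ks: "sum_list ks + s * (D - 1) \<le> N"
  shows "\<exists>b :: nat \<Rightarrow> 'v \<Rightarrow> real. (\<forall>i. linear (b i)) \<and>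
    (\<forall>i<N + m. \<forall>j<N + m. indep_on V b {i, j}) \<and>
    card (cells V b {..<N + m}) + 2 * ((m + 1) * (\<Sum>k\<leftarrow>ks. deficit k D) + s + ((N - 1) choose D))
      = 2 * regs (N + m) (Suc D)"
proof -
  \<comment> \<open>Form \<open>0\<close> of the paving on \<open>W\<close> is auxiliary: it is the common trace on \<open>W\<close> of the first two
    forms outside the cone, and the last \<open>s\<close> groups make it pass through \<open>s\<close> simple vertices.\<close>
  define ks' where "ks' = ks @ replicate s (D - 1)"
  define t where "t = length ks"
  define J where "J = {..<t + s}"
  define g where "g j = (if j < t then {} else {0}) \<union> block ks' j" for j
  have ks': "sum_list ks' \<le> N" using ks by (simp add: ks'_def sum_list_replicate)
  have blk: "block ks' j \<subseteq> {1..N}" for j using block_subset[of ks' j] ks' by fastforce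
  have cblk: "card (block ks' j) = (if j < t then ks ! j else D - 1)" if "j \<in> J" for j
    using that card_block[of j ks'] by (auto simp: J_def ks'_def t_def nth_append)
  obtain \<eta> :: "'v \<Rightarrow> real" and o' where \<eta>: "linear \<eta>" "o' \<in> V" "\<eta> o' = 1"
    using ex_linear_nonzero[OF V] by blast
  have sV: "subspace V" using V has_dim_subspace by blast
  define W where "W = ker_in V \<eta>"
  have W: "has_dim W D" using has_dim_ker[OF V \<eta>(1)] \<eta> unfolding W_def by (metis zero_neq_one)
  have sW: "subspace W" using W has_dim_subspace by blast
  have "g j \<inter> g k \<subseteq> {0}" if "j \<noteq> k" for j k
    using block_disjoint[OF that, of ks'] by (auto simp: g_def)
  then obtain a :: "nat \<Rightarrow> 'v \<Rightarrow> real" where "paving W D a {..N} J (\<lambda>j. g j \<inter> {..N})"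
    using paving_exists[OF W D, of J g N] by (auto simp: J_def)
  moreover have "g j \<inter> {..N} = g j" for j using blk[of j] by (auto simp: g_def)
  ultimately have pav: "paving W D a {..N} J g" by simp
  note P = pavingD[OF pav]
  have ins0: "insert 0 {1..N} = {..N}" by auto
  have pav0: "paving W D a {1..N} J (\<lambda>j. g j - {0})"
    using paving_delete[of W D a 0 "{1..N}" J g] pav ins0 by simp
  have gd0: "g j - {0} = block ks' j" for j using blk[of j] by (auto simp: g_def)
  define \<pi> where "\<pi> x = x - \<eta> x *\<^sub>R o'" for x
  have \<pi>W: "\<pi> x \<in> W" if "x \<in> V" for x
    using that \<eta> sV by (auto simp: \<pi>_def W_def subspace_diff subspace_scale linear_diff linear_scale)
  have \<pi>id: "\<pi> (y + r *\<^sub>R o') = y" if "y \<in> W" for y r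
    using that \<eta> by (simp add: \<pi>_def W_def linear_add linear_scale)
  have \<pi>W': "\<pi> y = y" if "y \<in> W" for y using that by (simp add: \<pi>_def W_def)
  have lin\<pi>: "linear \<pi>"
    unfolding \<pi>_def by (rule linearI) (use \<eta> in \<open>simp_all add: linear_add linear_scale algebra_simps\<close>)
  have linc: "linear (\<lambda>x. a i (\<pi> x))" for i
    using linear_compose[OF lin\<pi> P(4)[of i]] by (simp add: o_def)
  \<comment> \<open>Forms \<open>1\<close> to \<open>N\<close> factor through the projection along
    \<open>o'\<close>, hence vanish at the apex \<open>o'\<close>. Forms \<open>0\<close> and
    \<open>Suc N\<close> are the first two outside forms.\<close>
  define b where "b i = (if i = 0 then \<eta> else if i \<le> N then (\<lambda>x. a i (\<pi> x))
    else (\<lambda>x. \<eta> x - a 0 (\<pi> x)))" for i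
  have lin: "linear (b i)" for i
    using linc[of i] linear_compose_sub[OF \<eta>(1) linc[of 0]] \<eta>(1) by (simp add: b_def)
  have b0: "b 0 = \<eta>" and bi: "\<And>i. i \<in> {1..N} \<Longrightarrow> b i = (\<lambda>x. a i (\<pi> x))"
    and bN: "b (Suc N) = (\<lambda>x. \<eta> x - a 0 (\<pi> x))"
    by (auto simp: b_def)
  \<comment> \<open>\<open>U\<close> is the graph of \<open>a 0\<close> over \<open>W\<close> in the
    direction \<open>o'\<close>. It is a copy of \<open>W\<close> on which \<open>\<eta>\<close>
    takes the values of \<open>a 0\<close>; so the incidences prescribed for the auxiliary form
    become incidences of form \<open>0\<close> on \<open>U\<close>.\<close>
  define U where "U = ker_in V (b (Suc N))"
  have tVW: "\<exists>y\<in>W. \<forall>i\<in>{1..N}. b i x = a i y" if "x \<in> V" for x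
    using \<pi>W[OF that] bi by (intro bexI[of _ "\<pi> x"]) auto
  have tWV: "\<exists>x\<in>V. \<forall>i\<in>{1..N}. b i x = a i y" if "y \<in> W" for y
    using that bi \<pi>W' by (intro bexI[of _ y]) (auto simp: W_def)
  have tUW: "\<exists>y\<in>W. \<forall>i\<in>{..N}. b i x = a i y" if "x \<in> U" for x
  proof (rule bexI[of _ "\<pi> x"])
    show "\<pi> x \<in> W" using that \<pi>W by (simp add: U_def)
    show "\<forall>i\<in>{..N}. b i x = a i (\<pi> x)"
    proof
      fix i assume "i \<in> {..N}"
      show "b i x = a i (\<pi> x)"
      proof (cases "i = 0")
        case True
        then show ?thesis using that b0 bN by (simp add: U_def)
      qed (use \<open>i \<in> {..N}\<close> bi[of i] in simp)
    qed
  qed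
  have tWU: "\<exists>x\<in>U. \<forall>i\<in>{..N}. b i x = a i y" if "y \<in> W" for y
  proof -
    define x where "x = y + a 0 y *\<^sub>R o'"
    have x: "x \<in> V" "\<pi> x = y" "\<eta> x = a 0 y"
      using that \<eta> sV \<pi>id[OF that]
      by (auto simp: x_def W_def linear_add linear_scale subspace_add subspace_scale)
    have "b i x = a i y" if "i \<in> {..N}" for i
      using that x b0 bi[of i] by (cases "i = 0") auto
    moreover have "x \<in> U" using x bN by (simp add: U_def)
    ultimately show ?thesis by blast
  qed
  have nzN: "\<exists>x\<in>V. b (Suc N) x \<noteq> 0"
  proof -
    have "\<pi> o' = 0" using \<pi>id[of 0 1] sW by (simp add: subspace_0)
    then have "b (Suc N) o' = 1" using \<eta> P(4) by (simp add: bN linear_0)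
    then show ?thesis using \<eta> by (metis zero_neq_one)
  qed
  have nz0: "\<exists>x\<in>V. b 0 x \<noteq> 0" using \<eta> b0 by (metis zero_neq_one)
  have ker0: "ker_in V (b 0) = W" by (simp add: b0 W_def)
  define C where "C = card (cells W a {1..N})"
  define C0 where "C0 = card (cells W a {..N})"
  have "card (cells V b {..N}) = 2 * C"
  proof -
    have "cells V b {1..N} = cells W a {1..N}" "cells W b {1..N} = cells W a {1..N}"
      using tVW tWV \<pi>W' bi by (auto intro!: cells_transfer cells_cong)
    then show ?thesis
      using card_cells_insert[of V "{1..N}" 0 b] sV lin nz0 ker0 ins0 by (simp add: C_def)
  qed
  moreover have "cells U b {..N} = cells W a {..N}"
    using tUW tWU by (intro cells_transfer) auto
  moreover have "{..<N + 2} = insert (Suc N) {..N}" by auto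
  ultimately have count2: "card (cells V b {..<N + 2}) = 2 * C + C0"
    using card_cells_insert[of V "{..N}" "Suc N" b] sV lin nzN by (simp add: C0_def U_def)
  \<comment> \<open>Without form 0 the last \<open>s\<close> groups have only \<open>D - 1\<close>
    members and cost nothing. With it they have \<open>D\<close> members and cost 1 each.\<close>
  have d0: "(\<Sum>j\<in>J. deficit (card (g j - {0})) D) = (\<Sum>k\<leftarrow>ks. deficit k D)"
  proof -
    have "(\<Sum>j\<in>J. deficit (card (g j - {0})) D) = (\<Sum>j<t + s. if j < t then deficit (ks ! j) D else 0)"
      unfolding gd0 using cblk D by (intro sum.cong) (auto simp: J_def deficit_small)
    also have "\<dots> = (\<Sum>j<t. deficit (ks ! j) D)"
      unfolding t_def sum_append_block by simp
    finally show ?thesis by (simp add: t_def sum_list_sum_nth atLeast0LessThan)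
  qed
  have d1: "(\<Sum>j\<in>J. deficit (card (g j)) D) = (\<Sum>k\<leftarrow>ks. deficit k D) + s"
  proof -
    have "card (g j) = (if j < t then ks ! j else D)" if "j \<in> J" for j
    proof (cases "j < t")
      case False
      have "0 \<notin> block ks' j" "finite (block ks' j)" using blk[of j] by (auto simp: block_def)
      then show ?thesis using False cblk[OF that] D by (simp add: g_def)
    qed (use cblk[OF that] in \<open>simp add: g_def\<close>)
    then have "(\<Sum>j\<in>J. deficit (card (g j)) D) = (\<Sum>j<t + s. if j < t then deficit (ks ! j) D else 1)"
      using D by (intro sum.cong) (auto simp: J_def deficit_def)
    also have "\<dots> = (\<Sum>j<t. deficit (ks ! j) D) + s"
      unfolding t_def sum_append_block by simp
    finally show ?thesis by (simp add: t_def sum_list_sum_nth atLeast0LessThan)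
  qed
  have C: "C + 2 * (\<Sum>k\<leftarrow>ks. deficit k D) = 2 * regs N D"
    using card_cells_paving[OF _ _ pav0] d0 \<open>N \<ge> 1\<close> D by (simp add: C_def)
  have C0: "C0 + 2 * ((\<Sum>k\<leftarrow>ks. deficit k D) + s) = 2 * regs (Suc N) D"
    using card_cells_paving[OF _ _ pav] d1 D by (simp add: C0_def)
  \<comment> \<open>In \<open>V\<close> the \<open>s\<close> vertices only produce dependences among
    \<open>D + 1\<close> forms, namely \<open>0\<close>, \<open>Suc N\<close> and
    \<open>D - 1\<close> cone forms. Up to size \<open>D\<close> they are invisible, so only the
    first \<open>t\<close> groups remain.\<close>
  define J0 where "J0 = {..<t}"
  have gJ0: "g j = block ks' j" "card (g j) = ks ! j" if "j \<in> J0" for j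
    using that cblk[of j] by (auto simp: J0_def J_def g_def)
  have rank: "indep_on V b S \<longleftrightarrow> (card S = D \<longrightarrow> (\<forall>j\<in>J0. \<not> S \<subseteq> g j))"
    if S: "S \<subseteq> {..<N + 2}" "card S \<le> D" for S
  proof -
    have fin: "finite S" using S(1) finite_subset by blast
    have cR: "card (S - {i}) < D" if "i \<in> S" for i
      using card_Diff1_less[OF fin that] S(2) by linarith
    have nsub: "\<not> S \<subseteq> g j" if "i \<in> S" "i \<notin> {1..N}" "j \<in> J0" for i j
      using that gJ0(1) blk[of j] by blast
    consider "Suc N \<in> S" | "Suc N \<notin> S" "0 \<in> S" | "S \<subseteq> {1..N}"
    proof -
      have "i \<in> {1..N}" if "i \<in> S" "Suc N \<notin> S" "0 \<notin> S" for i
      proof -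
        have "i \<noteq> Suc N" "i \<noteq> 0" using that by metis+
        moreover have "i < N + 2" using that(1) S(1) by auto
        ultimately show ?thesis by auto
      qed
      then show ?thesis using that by blast
    qed
    then show ?thesis
    proof cases
      case 1
      define R where "R = S - {Suc N}"
      have R: "S = insert (Suc N) R" "Suc N \<notin> R" "R \<subseteq> {..N}"
        using 1 S(1) by (auto simp: R_def less_Suc_eq_le)
      have "indep_on W a R" using P(8)[OF R(3)] cR[OF 1] by (simp add: R_def)
      moreover have "indep_on U b R \<longleftrightarrow> indep_on W a R"
        using tUW tWU R(3) by (intro indep_on_transfer) blast+
      ultimately have "indep_on V b S"
        using indep_on_ker[of V b "Suc N" R] sV lin R nzN by (simp add: U_def)
      then show ?thesis using nsub[OF 1] by auto
    next
      case 2
      define R where "R = S - {0}"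
      have R: "S = insert 0 R" "0 \<notin> R" using 2 by (auto simp: R_def)
      have R1: "R \<subseteq> {1..N}"
      proof
        fix i assume i: "i \<in> R"
        then have "i \<noteq> Suc N" "i \<noteq> 0" "i < N + 2" using 2 S(1) by (auto simp: R_def)
        then show "i \<in> {1..N}" by auto
      qed
      then have "R \<subseteq> {..N}" by auto
      then have "indep_on W a R" using P(8)[of R] cR[OF 2(2)] by (simp add: R_def)
      moreover have "indep_on W b R \<longleftrightarrow> indep_on W a R"
        using R1 bi \<pi>W' by (intro indep_on_cong) (metis subsetD)
      ultimately have "indep_on V b S"
        using indep_on_ker[of V b 0 R] sV lin R nz0 ker0 by simp
      then show ?thesis using nsub[OF 2(2)] by auto
    next
      case 3
      then have "indep_on V b S \<longleftrightarrow> indep_on W a S"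
        using tVW tWV by (intro indep_on_transfer) blast+
      also have "\<dots> \<longleftrightarrow> (card S = D \<longrightarrow> (\<forall>j\<in>J. \<not> S \<subseteq> block ks' j))"
        using pav0 3 S(2) unfolding paving_def sparse_rank_def gd0 by blast
      also have "\<dots> \<longleftrightarrow> (card S = D \<longrightarrow> (\<forall>j\<in>J0. \<not> S \<subseteq> g j))"
      proof -
        have "\<not> S \<subseteq> block ks' j" if "j \<in> J" "j \<notin> J0" "card S = D" for j
        proof
          assume "S \<subseteq> block ks' j"
          then have "card S \<le> card (block ks' j)" by (intro card_mono) (auto simp: block_def)
          then show False using that cblk[OF that(1)] D by (auto simp: J0_def)
        qed
        then show ?thesis using gJ0(1) by (auto simp: J_def J0_def)
      qed
      finally show ?thesis .
    qed
  qed
  have sp: "sparse_rank V D b {..<N + 2} J0 g"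
  proof -
    have "finite J0" by (simp add: J0_def)
    have "J0 \<subseteq> J" by (auto simp: J0_def J_def)
    moreover have "g j \<subseteq> {..<N + 2}" if "j \<in> J0" for j
      using gJ0(1)[OF that] blk[of j] by auto
    ultimately show ?thesis
      unfolding sparse_rank_def using rank lin P(7) \<open>finite J0\<close> by (simp add: subset_iff)
  qed
  have "N + 2 + (m - 2) = N + m" "1 \<le> N + 2" "1 \<le> D" using \<open>m \<ge> 2\<close> D by auto
  from sparse_rank_generic_extend_many[OF V sp this(2,3), of "m - 2", unfolded this(1)] obtain c
    where c: "sparse_rank V D c {..<N + m} J0 g"
      "card (cells V c {..<N + m}) + 2 * ((m - 2) * (\<Sum>j\<in>J0. deficit (card (g j)) D)) + 2 * regs (N + 2) (Suc D)
        = card (cells V b {..<N + 2}) + 2 * regs (N + m) (Suc D)"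
    by blast
  have "(\<Sum>j\<in>J0. deficit (card (g j)) D) = (\<Sum>k\<leftarrow>ks. deficit k D)"
    using gJ0 by (simp add: J0_def t_def sum_list_sum_nth atLeast0LessThan)
  moreover have "regs (N + 2) (Suc D) = regs N (Suc D) + regs N D + regs (Suc N) D"
    using regs_Suc[of N D] regs_Suc[of "Suc N" D] \<open>N \<ge> 1\<close> by simp
  \<comment> \<open>This difference is the price of the common point: the \<open>N\<close> cone
    forms yield cells as in dimension \<open>D\<close> only.\<close>
  moreover have "regs N (Suc D) = regs N D + ((N - 1) choose D)" by (simp add: regs_def)
  moreover obtain m' where "m = m' + 2" using \<open>m \<ge> 2\<close> by (metis add.commute le_Suc_ex)
  ultimately have "card (cells V c {..<N + m}) + 2 * ((m + 1) * (\<Sum>k\<leftarrow>ks. deficit k D) + s + ((N - 1) choose D))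
      = 2 * regs (N + m) (Suc D)"
    using c(2) count2 C C0 by (simp add: algebra_simps)
  then show ?thesis
    using sparse_rankD(3)[OF c(1)] sparse_rank_pairs[OF c(1) D] by (intro exI[of _ c]) simp
qed

section \<open>Regions in projective space\<close>

instantiation "fun" :: (type, real_vector) real_vector
begin

definition "c *\<^sub>R f = (\<lambda>x. c *\<^sub>R f x)"

instance
  by standard (simp_all add: scaleR_fun_def fun_eq_iff scaleR_add_right scaleR_add_left)

end

lemma scaleR_fun_apply [simp]: "(c *\<^sub>R f) x = c *\<^sub>R f x"
  by (simp add: scaleR_fun_def)

abbreviation coord_space :: "nat \<Rightarrow> (nat \<Rightarrow> real) set" where
  "coord_space n \<equiv> {x. \<forall>i\<ge>n. x i = 0}"

abbreviation axis_fun :: "nat \<Rightarrow> nat \<Rightarrow> real" where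
  "axis_fun n \<equiv> (\<lambda>i. if i = n then 1 else 0)"

lemma coord_space_Suc_diff:
  assumes "x \<in> coord_space (Suc n)"
  shows "x - x n *\<^sub>R axis_fun n \<in> coord_space n"
proof -
  have "(x - x n *\<^sub>R axis_fun n) i = 0" if "i \<ge> n" for i
    using assms that by (cases "i = n") (auto simp: Suc_le_eq)
  then show ?thesis by blast
qed

lemma has_dim_coord_space: "has_dim (coord_space n) n"
proof (induction n)
  case 0
  have "coord_space 0 = {0}" by (auto simp: fun_eq_iff)
  then show ?case unfolding has_dim_def by (intro exI[of _ "{}"]) (simp add: independent_empty)
next
  case (Suc n)
  then obtain B where B: "finite B" "card B = n" "independent B" "span B = coord_space n"
    unfolding has_dim_def by blast
  have e: "axis_fun n \<notin> span B" unfolding B(4) by auto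
  then have "axis_fun n \<notin> B" using span_base by blast
  moreover have "span (insert (axis_fun n) B) = coord_space (Suc n)"
  proof (intro equalityI subsetI)
    fix x assume "x \<in> span (insert (axis_fun n) B)"
    then obtain k where "x - k *\<^sub>R axis_fun n \<in> coord_space n"
      unfolding span_breakdown_eq B(4) by blast
    then show "x \<in> coord_space (Suc n)" by (auto split: if_splits)
  next
    fix x assume "x \<in> coord_space (Suc n)"
    then show "x \<in> span (insert (axis_fun n) B)"
      unfolding span_breakdown_eq B(4) using coord_space_Suc_diff by blast
  qed
  ultimately show ?case
    unfolding has_dim_def using B independent_insertI[OF e]
    by (intro exI[of _ "insert (axis_fun n) B"]) simp
qed

text \<open>Only finitely many coordinates matter on \<open>coord_space n\<close>. This gives both
  the coefficient vector of a form and its continuity there.\<close>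

lemma linear_coord_space:
  assumes "linear (h :: (nat \<Rightarrow> real) \<Rightarrow> real)" "x \<in> coord_space n"
  shows "h x = (\<Sum>k<n. h (axis_fun k) * x k)"
  using assms(2)
proof (induction n arbitrary: x)
  case 0
  then have x0: "x = 0" by (auto simp: fun_eq_iff)
  have "h x = 0" unfolding x0 using assms(1) by (rule linear_0)
  then show ?case by simp
next
  case (Suc n)
  define y where "y = x - x n *\<^sub>R axis_fun n"
  have "y \<in> coord_space n" using Suc.prems coord_space_Suc_diff by (simp add: y_def)
  then have "h y = (\<Sum>k<n. h (axis_fun k) * y k)" by (rule Suc.IH)
  also have "\<dots> = (\<Sum>k<n. h (axis_fun k) * x k)" by (intro sum.cong) (auto simp: y_def)
  finally have "h y = (\<Sum>k<n. h (axis_fun k) * x k)" .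
  moreover have "h x = h y + x n * h (axis_fun n)"
    using assms(1) by (simp add: y_def linear_diff linear_scale)
  ultimately show ?case by simp
qed

text \<open>The complement of a part is the union of the other open parts, so each part is clopen as
  well as connected.\<close>

lemma connected_components_of_eq_partition:
  assumes un: "\<Union>\<P> = topspace Y" and dj: "pairwise disjnt \<P>"
    and P: "\<And>P. P \<in> \<P> \<Longrightarrow> openin Y P \<and> connectedin Y P \<and> P \<noteq> {}"
  shows "connected_components_of Y = \<P>"
proof -
  have comp: "connected_component_of_set Y x = P" if "P \<in> \<P>" "x \<in> P" for P x
  proof
    show "P \<subseteq> connected_component_of_set Y x"
      using P that by (intro connected_component_of_maximal) auto
    have "openin Y (\<Union>(\<P> - {P}))" using P by (intro openin_Union) auto
    moreover have "topspace Y - P = \<Union>(\<P> - {P})"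
      using dj that(1) unfolding un[symmetric] by (fastforce simp: pairwise_def disjnt_def)
    ultimately have "closedin Y P"
      using P[OF that(1)] by (simp add: closedin_def openin_subset)
    moreover have "x \<in> connected_component_of_set Y x"
      using that un connected_component_of_refl[of Y x] by blast
    ultimately show "connected_component_of_set Y x \<subseteq> P"
      using connectedin_clopen_cases[OF connectedin_connected_component_of, of Y P x] P[OF that(1)] that(2)
      unfolding disjnt_def by blast
  qed
  show ?thesis
  proof (intro equalityI subsetI)
    fix C assume "C \<in> connected_components_of Y"
    then obtain x where "x \<in> topspace Y" "C = connected_component_of_set Y x"
      by (auto simp: connected_components_of_def)
    then show "C \<in> \<P>" using comp un by blast
  next
    fix C assume C: "C \<in> \<P>"
    then obtain x where "x \<in> C" using P by blast
    then have "x \<in> topspace Y" "C = connected_component_of_set Y x" using comp[OF C] un C by blast+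
    then show "C \<in> connected_components_of Y" unfolding connected_components_of_def by blast
  qed
qed

definition hyperplane_of :: "nat \<Rightarrow> ((nat \<Rightarrow> real) \<Rightarrow> real) \<Rightarrow> (nat \<Rightarrow> real) set set" where
  "hyperplane_of d h = {l \<in> topspace (real_projective_space d). \<forall>x\<in>l. h x = 0}"

lemma topspace_punctured_space: "topspace (punctured_space m) = coord_space m - {\<lambda>_. 0}"
  by (auto simp: punctured_space_def topspace_Euclidean_space)

lemma line_through_eq_iff:
  assumes "x \<noteq> (\<lambda>_. 0)"
  shows "line_through x = line_through y \<longleftrightarrow> (\<exists>c. c \<noteq> 0 \<and> y = c *\<^sub>R x)"
proof
  assume eq: "line_through x = line_through y"
  have "y \<in> line_through y" "x \<in> line_through x"
    unfolding line_through_def by (auto intro: range_eqI[of _ _ 1])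
  then have "y \<in> line_through x" "x \<in> line_through y" using eq by auto
  then obtain c e where c: "y = (\<lambda>i. c * x i)" and e: "x = (\<lambda>i. e * y i)"
    unfolding line_through_def by blast
  have "c \<noteq> 0"
  proof
    assume "c = 0"
    then have "y = (\<lambda>_. 0)" using c by simp
    then have "x = (\<lambda>_. 0)" using e by simp
    then show False using assms by blast
  qed
  then show "\<exists>c. c \<noteq> 0 \<and> y = c *\<^sub>R x" using c by (auto simp: scaleR_fun_def)
next
  assume "\<exists>c. c \<noteq> 0 \<and> y = c *\<^sub>R x"
  then obtain c where c: "c \<noteq> 0" "y = c *\<^sub>R x" by blast
  have "(\<lambda>i. r * x i) = (\<lambda>i. (r / c) * y i)" "(\<lambda>i. r * y i) = (\<lambda>i. (r * c) * x i)" for r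
    using c by (auto simp: fun_eq_iff)
  then have "(\<lambda>i. r * x i) \<in> range (\<lambda>r i. r * y i)" "(\<lambda>i. r * y i) \<in> range (\<lambda>r i. r * x i)" for r
    by (metis rangeI)+
  then show "line_through x = line_through y"
    unfolding line_through_def by blast
qed

lemma line_through_in_hyperplane_of:
  assumes "linear h" "x \<in> topspace (punctured_space (Suc d))"
  shows "line_through x \<in> hyperplane_of d h \<longleftrightarrow> h x = 0"
proof -
  have "(\<lambda>i. c * x i) = c *\<^sub>R x" for c by (simp add: scaleR_fun_def)
  then have "h (\<lambda>i. c * x i) = c * h x" for c using assms(1) by (simp add: linear_scale)
  then have "(\<forall>y\<in>line_through x. h y = 0) \<longleftrightarrow> h x = 0"
    unfolding line_through_def by (auto dest: spec[of _ 1])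
  then show ?thesis using assms(2) by (simp add: hyperplane_of_def topspace_real_projective_space)
qed

text \<open>Passes between coefficient vectors and the abstract forms with which arrangements are
  built and counted; the coefficients are the values on the axes.\<close>

lemma projective_hyperplane_iff:
  "projective_hyperplane d H \<longleftrightarrow>
    (\<exists>h. linear h \<and> (\<exists>x\<in>coord_space (Suc d). h x \<noteq> 0) \<and> H = hyperplane_of d h)"
proof
  assume "projective_hyperplane d H"
  then obtain a i where a: "i \<le> d" "a i \<noteq> 0"
    "H = {l \<in> topspace (real_projective_space d). \<forall>x\<in>l. (\<Sum>i\<le>d. a i * x i) = 0}"
    unfolding projective_hyperplane_def by blast
  define h where "h x = (\<Sum>i\<le>d. a i * x i)" for x :: "nat \<Rightarrow> real"
  have "linear h"
    unfolding h_def by (rule linearI) (simp_all add: algebra_simps sum.distrib sum_distrib_left)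
  moreover have "h (axis_fun i) = (\<Sum>k\<le>d. if k = i then a k else 0)"
    unfolding h_def by (intro sum.cong) auto
  then have "h (axis_fun i) \<noteq> 0" using a(1,2) by simp
  moreover have "axis_fun i \<in> coord_space (Suc d)" using a(1) by auto
  moreover have "H = hyperplane_of d h" unfolding a(3) hyperplane_of_def h_def ..
  ultimately show "\<exists>h. linear h \<and> (\<exists>x\<in>coord_space (Suc d). h x \<noteq> 0) \<and> H = hyperplane_of d h" by blast
next
  assume "\<exists>h. linear h \<and> (\<exists>x\<in>coord_space (Suc d). h x \<noteq> 0) \<and> H = hyperplane_of d h"
  then obtain h x where h: "linear h" "x \<in> coord_space (Suc d)" "h x \<noteq> 0" "H = hyperplane_of d h"
    by blast
  define a where "a k = h (axis_fun k)" for k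
  have ha: "h y = (\<Sum>i\<le>d. a i * y i)" if "y \<in> coord_space (Suc d)" for y
    using linear_coord_space[OF h(1) that] by (simp add: a_def lessThan_Suc_atMost)
  have "\<exists>i\<le>d. a i \<noteq> 0"
    using h(2,3) ha by (metis (no_types, lifting) atMost_iff mult_zero_left sum.neutral)
  moreover have "y \<in> coord_space (Suc d)" if "l \<in> topspace (real_projective_space d)" "y \<in> l" for l y
    using that by (auto simp: topspace_real_projective_space topspace_punctured_space line_through_def)
  then have "(\<forall>x\<in>l. h x = 0) \<longleftrightarrow> (\<forall>x\<in>l. (\<Sum>i\<le>d. a i * x i) = 0)"
    if "l \<in> topspace (real_projective_space d)" for l
    using that by (intro ball_cong refl) (simp only: ha)
  then have "H = {l \<in> topspace (real_projective_space d). \<forall>x\<in>l. (\<Sum>i\<le>d. a i * x i) = 0}"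
    unfolding h(4) hyperplane_of_def by (intro Collect_cong conj_cong refl) simp
  ultimately show "projective_hyperplane d H" unfolding projective_hyperplane_def by blast
qed

lemma continuous_on_linear_coord_space:
  assumes "linear (h :: (nat \<Rightarrow> real) \<Rightarrow> real)"
  shows "continuous_on (coord_space n) h"
proof -
  have "continuous_on (coord_space n) (\<lambda>x. \<Sum>k<n. h (axis_fun k) * x k)"
    by (intro continuous_intros continuous_on_subset[OF continuous_on_product_coordinates]) auto
  moreover have "continuous_on (coord_space n) h
      \<longleftrightarrow> continuous_on (coord_space n) (\<lambda>x. \<Sum>k<n. h (axis_fun k) * x k)"
    by (intro continuous_on_cong refl linear_coord_space[OF assms])
  ultimately show ?thesis by blast
qed

section \<open>Sign cones and regions\<close>

text \<open>Having at least one form keeps 0 out of \<open>sign_cone J\<close> for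
  \<open>J \<subseteq> I\<close>, so that these cones consist of points of the punctured space and
  opposite cones are different.\<close>

locale linear_forms =
  fixes d :: nat and b :: "'i \<Rightarrow> (nat \<Rightarrow> real) \<Rightarrow> real" and I :: "'i set"
  assumes lin: "\<And>i. linear (b i)" and fin: "finite I" and ne: "I \<noteq> {}"
begin

definition sign_cone :: "'i set \<Rightarrow> (nat \<Rightarrow> real) set" where
  "sign_cone J = {x \<in> coord_space (Suc d). (\<forall>i\<in>J. b i x > 0) \<and> (\<forall>i\<in>I - J. b i x < 0)}"

abbreviation "X \<equiv> punctured_space (Suc d)"

abbreviation "Z \<equiv> topspace (real_projective_space d) - \<Union>(hyperplane_of d ` b ` I)"

lemma cells_iff: "J \<in> cells (coord_space (Suc d)) b I \<longleftrightarrow> J \<subseteq> I \<and> sign_cone J \<noteq> {}"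
  unfolding cells_def sign_cone_def by blast

lemma sign_coneD:
  assumes "x \<in> sign_cone J"
  shows "x \<in> coord_space (Suc d)" "i \<in> J \<Longrightarrow> b i x > 0" "i \<in> I \<Longrightarrow> i \<notin> J \<Longrightarrow> b i x < 0"
  using assms unfolding sign_cone_def by blast+

lemma cone_nonzero: "x \<in> sign_cone J \<Longrightarrow> i \<in> I \<Longrightarrow> b i x \<noteq> 0"
  using sign_coneD(2,3) by (metis less_irrefl)

lemma cone_subset: "sign_cone J \<subseteq> topspace X" if "J \<subseteq> I"
proof
  fix x assume x: "x \<in> sign_cone J"
  obtain i where "i \<in> I" using ne by blast
  then have "b i x \<noteq> 0" using x cone_nonzero by blast
  moreover have "b i 0 = 0" using lin by (simp add: linear_0)
  ultimately have "x \<noteq> 0" by auto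
  then show "x \<in> topspace X" using x by (auto simp: sign_cone_def topspace_punctured_space zero_fun_def)
qed

lemma neg_cone: "J \<subseteq> I \<Longrightarrow> - x \<in> sign_cone J \<longleftrightarrow> x \<in> sign_cone (I - J)"
  using lin by (auto simp: sign_cone_def linear_neg)

lemma scale_cone: "x \<in> sign_cone J \<Longrightarrow> c > 0 \<Longrightarrow> c *\<^sub>R x \<in> sign_cone J"
  using lin by (auto simp: sign_cone_def linear_scale mult_pos_neg)

lemma cone_cover:
  assumes "x \<in> coord_space (Suc d)" "\<And>i. i \<in> I \<Longrightarrow> b i x \<noteq> 0"
  shows "x \<in> sign_cone {i\<in>I. b i x > 0}"
  using assms by (auto simp: sign_cone_def not_less less_le)

lemma cone_unique: "x \<in> sign_cone J \<Longrightarrow> x \<in> sign_cone K \<Longrightarrow> J \<subseteq> I \<Longrightarrow> K \<subseteq> I \<Longrightarrow> J = K"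
proof -
  have "L = {i\<in>I. b i x > 0}" if "x \<in> sign_cone L" "L \<subseteq> I" for L
  proof -
    have "i \<in> L \<longleftrightarrow> b i x > 0" if "i \<in> I" for i
      using sign_coneD(2,3)[OF \<open>x \<in> sign_cone L\<close>] that by (metis less_asym)
    then show ?thesis using \<open>L \<subseteq> I\<close> by blast
  qed
  then show "x \<in> sign_cone J \<Longrightarrow> x \<in> sign_cone K \<Longrightarrow> J \<subseteq> I \<Longrightarrow> K \<subseteq> I \<Longrightarrow> J = K" by blast
qed

text \<open>A sign cone is convex, so segments serve as paths.\<close>

lemma connectedin_cone: "connectedin (Euclidean_space (Suc d)) (sign_cone J)"
proof -
  have "path_connected (sign_cone J)"
    unfolding path_connected_def
  proof (intro ballI)
    fix x y assume xy: "x \<in> sign_cone J" "y \<in> sign_cone J"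
    define g where "g t = (\<lambda>i. (1 - t) * x i + t * y i)" for t
    have g: "g t = (1 - t) *\<^sub>R x + t *\<^sub>R y" for t by (auto simp: g_def fun_eq_iff)
    have bg: "b i (g t) = (1 - t) * b i x + t * b i y" for i t
      using lin[of i] by (simp only: g linear_add linear_scale real_scaleR_def)
    have "g t \<in> sign_cone J" if "t \<in> {0..1}" for t
    proof -
      have pos: "0 < (1 - t) * u + t * v" if "0 < u" "0 < v" for u v
        using that \<open>t \<in> {0..1}\<close> by (cases "t = 0") (auto intro!: add_nonneg_pos)
      have "b i (g t) > 0" if "i \<in> J" for i
        using that xy pos[of "b i x" "b i y"] by (simp add: bg sign_cone_def)
      moreover have "b i (g t) < 0" if "i \<in> I - J" for i
      proof -
        have "0 < (1 - t) * (- b i x) + t * (- b i y)"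
          using that xy by (intro pos) (simp_all add: sign_cone_def)
        then show ?thesis unfolding bg by (simp add: algebra_simps)
      qed
      moreover have "g t \<in> coord_space (Suc d)" using xy by (auto simp: g_def sign_cone_def)
      ultimately show ?thesis by (simp add: sign_cone_def)
    qed
    moreover have "path g"
      unfolding path_def g_def by (intro continuous_intros)
    moreover have "g 0 = x" "g 1 = y" by (auto simp: g_def)
    ultimately show "\<exists>g. path g \<and> path_image g \<subseteq> sign_cone J \<and> pathstart g = x \<and> pathfinish g = y"
      by (intro exI[of _ g]) (auto simp: path_image_def pathstart_def pathfinish_def)
  qed
  then have "connected (sign_cone J)" by (rule path_connected_imp_connected)
  then show ?thesis
    by (auto simp: Euclidean_space_def connectedin_subtopology euclidean_product_topology sign_cone_def)
qed

lemma openin_cone: "openin (Euclidean_space (Suc d)) (sign_cone J)" if "J \<subseteq> I"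
proof -
  have E: "Euclidean_space (Suc d) = top_of_set (coord_space (Suc d))"
    by (simp add: Euclidean_space_def euclidean_product_topology)
  have op: "openin (top_of_set (coord_space (Suc d))) (coord_space (Suc d) \<inter> b i -` T)" if "open T" for T i
    by (rule continuous_openin_preimage_gen[OF continuous_on_linear_coord_space[OF lin] that])
  have "x \<in> sign_cone J \<longleftrightarrow> x \<in> coord_space (Suc d) \<and> (\<forall>i\<in>I. b i x \<in> (if i \<in> J then {0<..} else {..<0}))" for x
  proof -
    have "(\<forall>i\<in>I. b i x \<in> (if i \<in> J then {0<..} else {..<0}))
        \<longleftrightarrow> (\<forall>i\<in>I. (i \<in> J \<longrightarrow> b i x > 0) \<and> (i \<notin> J \<longrightarrow> b i x < 0))"
      by (intro ball_cong refl) simp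
    then show ?thesis using that unfolding sign_cone_def by blast
  qed
  then have "sign_cone J = coord_space (Suc d) \<inter>
      \<Inter>((\<lambda>i. coord_space (Suc d) \<inter> b i -` (if i \<in> J then {0<..} else {..<0})) ` I)"
    by (intro set_eqI) (simp only: Int_iff INT_iff vimage_eq, blast)
  also have "openin (top_of_set (coord_space (Suc d))) \<dots>"
    using op fin ne by (intro openin_Int openin_Inter) auto
  finally show ?thesis unfolding E .
qed

text \<open>A line meets the cone of \<open>J\<close> in a positive or a negative multiple of
  \<open>x\<close>. The preimage of a region under the quotient map is thus a pair of opposite
  cones.\<close>

lemma line_through_in_cone_image:
  assumes "J \<subseteq> I" "x \<in> topspace X"
  shows "line_through x \<in> line_through ` sign_cone J \<longleftrightarrow> x \<in> sign_cone J \<or> x \<in> sign_cone (I - J)"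
proof
  assume "line_through x \<in> line_through ` sign_cone J"
  then obtain y where y: "y \<in> sign_cone J" "line_through x = line_through y" by blast
  then have "y \<noteq> (\<lambda>_. 0)" using cone_subset[OF assms(1)] by (auto simp: topspace_punctured_space)
  then obtain c where c: "c \<noteq> 0" "x = c *\<^sub>R y" using line_through_eq_iff[of y x] y by auto
  show "x \<in> sign_cone J \<or> x \<in> sign_cone (I - J)"
  proof (cases "c > 0")
    case True
    then show ?thesis using scale_cone y c by blast
  next
    case False
    then have "(- c) *\<^sub>R y \<in> sign_cone J" using c by (intro scale_cone y(1)) simp
    then show ?thesis using c neg_cone[OF assms(1), of x] by simp
  qed
next
  have "x \<noteq> (\<lambda>_. 0)" using assms(2) by (auto simp: topspace_punctured_space)
  moreover have "- x = (- 1) *\<^sub>R x" by simp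
  then have "\<exists>c. c \<noteq> 0 \<and> - x = c *\<^sub>R x" by (metis neg_equal_0_iff_equal one_neq_zero)
  ultimately have neg: "line_through x = line_through (- x)"
    using line_through_eq_iff[of x "- x"] by blast
  assume "x \<in> sign_cone J \<or> x \<in> sign_cone (I - J)"
  then show "line_through x \<in> line_through ` sign_cone J"
  proof
    assume "x \<in> sign_cone (I - J)"
    then have "- x \<in> sign_cone J" using neg_cone[OF assms(1)] by blast
    then show ?thesis unfolding neg by (rule imageI)
  qed (rule imageI)
qed

lemma line_through_cone_compl:
  assumes "J \<subseteq> I"
  shows "line_through ` sign_cone (I - J) = line_through ` sign_cone J"
proof -
  have "line_through ` sign_cone (I - L) \<subseteq> line_through ` sign_cone L" if "L \<subseteq> I" for L
    using line_through_in_cone_image[OF that] cone_subset[of "I - L"] by blast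
  from this[of J] this[of "I - J"] assms show ?thesis by (simp add: double_diff)
qed

lemma line_through_in_complement:
  assumes "x \<in> topspace X"
  shows "line_through x \<in> Z \<longleftrightarrow> (\<forall>i\<in>I. b i x \<noteq> 0)"
  using assms line_through_in_hyperplane_of[OF lin assms] topspace_real_projective_space by auto

text \<open>The image of a cone is open because its preimage consists of two open cones, and
  connected as a continuous image. Two images that meet come from equal or complementary index sets
  and coincide.\<close>

lemma regions_eq:
  "regions d (hyperplane_of d ` b ` I)
    = (\<lambda>J. line_through ` sign_cone J) ` cells (coord_space (Suc d)) b I"
  unfolding regions_def
proof (rule connected_components_of_eq_partition)
  let ?\<C> = "cells (coord_space (Suc d)) b I"
  let ?Y = "subtopology (real_projective_space d) Z"
  have sub: "line_through ` sign_cone J \<subseteq> Z" if "J \<subseteq> I" for J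
    using cone_subset[OF that] line_through_in_complement cone_nonzero by blast
  show "\<Union>((\<lambda>J. line_through ` sign_cone J) ` ?\<C>) = topspace ?Y"
  proof
    have "line_through ` sign_cone J \<subseteq> Z" if "J \<in> ?\<C>" for J
      using sub[of J] that cells_iff by blast
    then show "\<Union>((\<lambda>J. line_through ` sign_cone J) ` ?\<C>) \<subseteq> topspace ?Y"
      unfolding topspace_subtopology by blast
    show "topspace ?Y \<subseteq> \<Union>((\<lambda>J. line_through ` sign_cone J) ` ?\<C>)"
    proof
      fix l assume "l \<in> topspace ?Y"
      then have l: "l \<in> Z" by simp
      then obtain x where x: "x \<in> topspace X" "l = line_through x"
        by (auto simp: topspace_real_projective_space)
      then have "x \<in> sign_cone {i\<in>I. b i x > 0}"
        using l line_through_in_complement[OF x(1)] cone_cover[of x] by (auto simp: topspace_punctured_space)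
      then show "l \<in> \<Union>((\<lambda>J. line_through ` sign_cone J) ` ?\<C>)"
        using x by (auto simp: cells_iff intro!: bexI[of _ "{i\<in>I. b i x > 0}"])
    qed
  qed
  show "pairwise disjnt ((\<lambda>J. line_through ` sign_cone J) ` ?\<C>)"
  proof (rule pairwiseI)
    fix P Q assume "P \<in> (\<lambda>J. line_through ` sign_cone J) ` ?\<C>" "Q \<in> (\<lambda>J. line_through ` sign_cone J) ` ?\<C>" "P \<noteq> Q"
    then obtain J K where "J \<in> ?\<C>" "K \<in> ?\<C>" and PQ: "P = line_through ` sign_cone J" "Q = line_through ` sign_cone K"
      by blast
    then have J: "J \<subseteq> I" "P = line_through ` sign_cone J" and K: "K \<subseteq> I" "Q = line_through ` sign_cone K"
      using cells_iff by blast+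
    show "disjnt P Q"
    proof (rule ccontr)
      assume "\<not> disjnt P Q"
      then obtain z where z: "z \<in> P" "z \<in> Q" by (auto simp: disjnt_def)
      then obtain x where "x \<in> sign_cone K" "z = line_through x" using K(2) by blast
      then have x: "x \<in> sign_cone K" "line_through x \<in> line_through ` sign_cone J" using z(1) J(2) by blast+
      moreover have "x \<in> topspace X" using x(1) cone_subset[OF K(1)] by blast
      ultimately have "x \<in> sign_cone J \<or> x \<in> sign_cone (I - J)"
        using line_through_in_cone_image[OF J(1)] by blast
      then have "K = J \<or> K = I - J" using cone_unique x(1) J(1) K(1) by blast
      then show False using line_through_cone_compl J K \<open>P \<noteq> Q\<close> by blast
    qed
  qed
  fix P assume "P \<in> (\<lambda>J. line_through ` sign_cone J) ` ?\<C>"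
  then obtain J where "J \<in> ?\<C>" and "P = line_through ` sign_cone J" by blast
  then have J: "J \<subseteq> I" "sign_cone J \<noteq> {}" "P = line_through ` sign_cone J"
    using cells_iff by blast+
  have PZ: "P \<subseteq> Z" using sub J by simp
  have "openin (real_projective_space d) P"
    unfolding openin_real_projective_space
  proof
    show "P \<subseteq> line_through ` topspace X" using cone_subset[OF J(1)] J by blast
    have "{x \<in> topspace X. line_through x \<in> P} = topspace X \<inter> (sign_cone J \<union> sign_cone (I - J))"
      using line_through_in_cone_image[OF J(1)] J(3) by blast
    moreover have "openin (Euclidean_space (Suc d)) (sign_cone J \<union> sign_cone (I - J))"
      using openin_cone[OF J(1)] openin_cone[of "I - J"] by blast
    moreover have "topspace X \<inter> (sign_cone J \<union> sign_cone (I - J)) = (sign_cone J \<union> sign_cone (I - J)) \<inter> - {\<lambda>_. 0}"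
      using cone_subset[OF J(1)] cone_subset[of "I - J"] by (auto simp: topspace_punctured_space)
    ultimately show "openin X {x \<in> topspace X. line_through x \<in> P}"
      unfolding punctured_space_def openin_subtopology by auto
  qed
  then have "openin ?Y P" using PZ by (auto simp: openin_subtopology)
  moreover have "connectedin ?Y P"
  proof -
    have "connectedin X (sign_cone J)"
      using connectedin_cone cone_subset[OF J(1)]
      by (auto simp: punctured_space_def connectedin_subtopology topspace_Euclidean_space)
    then have "connectedin (real_projective_space d) P"
      unfolding J(3)
      by (rule connectedin_continuous_map_image[OF quotient_imp_continuous_map[OF quotient_map_line_through]])
    then show ?thesis using PZ by (simp add: connectedin_subtopology)
  qed
  ultimately show "openin ?Y P \<and> connectedin ?Y P \<and> P \<noteq> {}" using J by blast
qed

text \<open>Exactly \<open>J\<close> and \<open>I - J\<close> give the same region. Fixing one index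
  \<open>i\<close> selects the member of each pair that contains \<open>i\<close>.\<close>

theorem card_regions:
  "finite (regions d (hyperplane_of d ` b ` I))"
  "2 * card (regions d (hyperplane_of d ` b ` I)) = card (cells (coord_space (Suc d)) b I)"
proof -
  let ?\<C> = "cells (coord_space (Suc d)) b I"
  obtain i where i: "i \<in> I" using ne by blast
  define \<P> where "\<P> = {J\<in>?\<C>. i \<in> J}"
  define \<N> where "\<N> = {J\<in>?\<C>. i \<notin> J}"
  have fC: "finite ?\<C>" using fin by (rule finite_cells)
  show "finite (regions d (hyperplane_of d ` b ` I))" unfolding regions_eq using fC by blast
  have compl: "I - J \<in> ?\<C>" if J: "J \<in> ?\<C>" for J
  proof -
    have J': "J \<subseteq> I" "I - (I - J) = J" using J by (auto simp: cells_iff double_diff)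
    obtain x where "x \<in> sign_cone J" using J by (auto simp: cells_iff)
    then have "- x \<in> sign_cone (I - J)" using neg_cone[of "I - J" x] J' by simp
    then show ?thesis by (auto simp: cells_iff)
  qed
  have "bij_betw (\<lambda>J. I - J) \<P> \<N>"
  proof (rule bij_betwI)
    show "(\<lambda>J. I - J) \<in> \<P> \<rightarrow> \<N>" "(\<lambda>J. I - J) \<in> \<N> \<rightarrow> \<P>"
      using compl i by (auto simp: \<P>_def \<N>_def)
  qed (auto simp: \<P>_def \<N>_def cells_iff)
  then have "card \<P> = card \<N>" by (rule bij_betw_same_card)
  moreover have "card ?\<C> = card \<P> + card \<N>"
  proof -
    have "?\<C> = \<P> \<union> \<N>" "\<P> \<inter> \<N> = {}" by (auto simp: \<P>_def \<N>_def)
    then show ?thesis using fC by (metis card_Un_disjoint finite_Un)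
  qed
  moreover have "regions d (hyperplane_of d ` b ` I) = (\<lambda>J. line_through ` sign_cone J) ` \<P>"
  proof -
    have "line_through ` sign_cone J \<in> (\<lambda>J. line_through ` sign_cone J) ` \<P>" if J: "J \<in> ?\<C>" for J
    proof (cases "i \<in> J")
      case True
      then show ?thesis using J by (auto simp: \<P>_def)
    next
      case False
      then have "I - J \<in> \<P>" using compl[OF J] i by (simp add: \<P>_def)
      moreover have "J \<subseteq> I" using J by (simp add: cells_iff)
      ultimately show ?thesis using line_through_cone_compl by (metis imageI)
    qed
    then show ?thesis unfolding regions_eq by (auto simp: \<P>_def)
  qed
  moreover have "inj_on (\<lambda>J. line_through ` sign_cone J) \<P>"
  proof (rule inj_onI)
    fix J K assume J: "J \<in> \<P>" and K: "K \<in> \<P>" and eq: "line_through ` sign_cone J = line_through ` sign_cone K"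
    have JK: "J \<subseteq> I" "K \<subseteq> I" "i \<in> J" "i \<in> K" using J K by (auto simp: \<P>_def cells_iff)
    obtain x where x: "x \<in> sign_cone K" using K by (auto simp: \<P>_def cells_iff)
    then have "line_through x \<in> line_through ` sign_cone J" "x \<in> topspace X"
      using eq cone_subset[OF JK(2)] by blast+
    then have "x \<in> sign_cone J \<or> x \<in> sign_cone (I - J)"
      using line_through_in_cone_image[OF JK(1)] by blast
    then have "K = J \<or> K = I - J" using cone_unique x JK by blast
    then show "J = K" using JK by blast
  qed
  ultimately show "2 * card (regions d (hyperplane_of d ` b ` I)) = card ?\<C>"
    by (simp add: card_image)
qed

end

section \<open>Arrangements as families of forms\<close>

lemma card_regions_le:
  assumes A: "arrangement n d A" and "n \<ge> 1"
  shows "finite (regions d A)" "card (regions d A) \<le> regs n (Suc d)"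
proof -
  have fA: "finite A" "card A = n" "A \<noteq> {}"
    and hA: "\<forall>H\<in>A. \<exists>h. linear h \<and> H = hyperplane_of d h"
    using A \<open>n \<ge> 1\<close> by (auto simp: arrangement_def projective_hyperplane_iff)
  from bchoice[OF hA] obtain h where h: "\<forall>H\<in>A. linear (h H) \<and> H = hyperplane_of d (h H)" ..
  \<comment> \<open>The hyperplanes themselves serve as indices. The zero form outside
    \<open>A\<close> makes every \<open>b H\<close> linear, as the locale demands.\<close>
  define b where "b H = (if H \<in> A then h H else (\<lambda>_. 0))" for H
  have lin: "linear (b H)" for H using h by (simp add: b_def linear_zero)
  then interpret linear_forms d b A by (rule linear_forms.intro) (rule fA)+
  have im: "hyperplane_of d ` b ` A = A"
  proof -
    have "hyperplane_of d (b H) = H" if "H \<in> A" for H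
      using h that unfolding b_def by (metis (full_types))
    then show ?thesis by (force simp: image_iff)
  qed
  show "finite (regions d A)" using card_regions(1) im by simp
  show "card (regions d A) \<le> regs n (Suc d)"
    using card_regions(2) im card_cells_le[of b A "coord_space (Suc d)" "Suc d"] lin fA
      has_dim_coord_space[of "Suc d"] by simp
qed

text \<open>Independence of \<open>{i, j}\<close> separates the two hyperplanes by a point of one
  that misses the other. The case \<open>i = j\<close> says that the form is not zero.\<close>

lemma arrangement_of_forms:
  fixes b :: "nat \<Rightarrow> (nat \<Rightarrow> real) \<Rightarrow> real"
  assumes lin: "\<And>i. linear (b i)" and "n \<ge> 1"
    and ind: "\<And>i j. i < n \<Longrightarrow> j < n \<Longrightarrow> indep_on (coord_space (Suc d)) b {i, j}"
  shows "\<exists>A. arrangement n d A \<and> finite (regions d A) \<and>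
    2 * card (regions d A) = card (cells (coord_space (Suc d)) b {..<n})"
proof -
  let ?H = "\<lambda>i. hyperplane_of d (b i)"
  interpret linear_forms d b "{..<n}"
    by (rule linear_forms.intro) (use assms in \<open>auto simp: lessThan_empty_iff\<close>)
  have "projective_hyperplane d (?H i)" if "i < n" for i
  proof -
    have "\<exists>x\<in>coord_space (Suc d). \<forall>k\<in>{i, i}. b k x = (\<lambda>_. 1) k"
      using ind[OF that that] unfolding indep_on_def by (rule spec)
    then have "\<exists>x\<in>coord_space (Suc d). b i x \<noteq> 0" by auto
    then show ?thesis unfolding projective_hyperplane_iff using lin[of i] by blast
  qed
  moreover have "inj_on ?H {..<n}"
  proof (rule inj_onI, rule ccontr)
    fix i j assume ij: "i \<in> {..<n}" "j \<in> {..<n}" "?H i = ?H j" "i \<noteq> j"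
    then have "indep_on (coord_space (Suc d)) b {i, j}" using ind by simp
    then have "\<exists>x\<in>coord_space (Suc d). \<forall>k\<in>{i, j}. b k x = (\<lambda>k. if k = i then 0 else 1) k"
      unfolding indep_on_def by (rule spec)
    then obtain x where x: "x \<in> coord_space (Suc d)" "b i x = 0" "b j x = 1"
      using ij(4) by auto
    have "x \<noteq> 0"
    proof
      assume "x = 0"
      then have "b j x = 0" using lin linear_0 by blast
      then show False using x by simp
    qed
    then have "x \<in> topspace (punctured_space (Suc d))"
      using x(1) by (simp add: topspace_punctured_space zero_fun_def)
    then have "line_through x \<in> ?H i \<longleftrightarrow> b i x = 0" "line_through x \<in> ?H j \<longleftrightarrow> b j x = 0"
      using line_through_in_hyperplane_of lin by blast+
    then show False using x(2,3) ij(3) by simp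
  qed
  ultimately have "arrangement n d (?H ` {..<n})"
    unfolding arrangement_def by (auto simp: card_image)
  then show ?thesis
    using card_regions by (intro exI[of _ "?H ` {..<n}"]) (simp add: image_image)
qed

lemma realize_disjoint_points:
  assumes "d \<ge> 2" "sum_list ks < n" and f: "f + (\<Sum>k\<leftarrow>ks. deficit k (Suc d)) = regs n (Suc d)"
  shows "\<exists>A. arrangement n d A \<and> finite (regions d A) \<and> card (regions d A) = f"
proof -
  obtain m where n: "n = Suc m" using assms(2) by (cases n) auto
  obtain a :: "nat \<Rightarrow> (nat \<Rightarrow> real) \<Rightarrow> real" where a: "\<forall>i. linear (a i)"
    "\<forall>i\<le>m. \<forall>j\<le>m. indep_on (coord_space (Suc d)) a {i, j}"
    "card (cells (coord_space (Suc d)) a {..m}) + 2 * (\<Sum>k\<leftarrow>ks. deficit k (Suc d)) = 2 * regs (Suc m) (Suc d)"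
    using arrangement_with_disjoint_points[OF has_dim_coord_space, of "Suc d" ks m] assms n by auto
  then obtain A where A: "arrangement n d A" "finite (regions d A)"
    "2 * card (regions d A) = card (cells (coord_space (Suc d)) a {..<n})"
    using arrangement_of_forms[of a n d] n by (auto simp: less_Suc_eq_le)
  then have "card (regions d A) = f"
    using a(3) f n by (simp add: lessThan_Suc_atMost)
  then show ?thesis using A by blast
qed

text \<open>The space has dimension \<open>Suc d\<close> and the base of the cone has dimension
  \<open>d\<close>, which is why the deficits are taken in rank \<open>d\<close> here and in rank
  \<open>Suc d\<close> for disjoint points.\<close>

lemma realize_cone:
  assumes "d \<ge> 3" "m \<ge> 2" "N \<ge> 1" "sum_list ks + s * (d - 1) \<le> N"
    and f: "f + ((m + 1) * (\<Sum>k\<leftarrow>ks. deficit k d) + s + ((N - 1) choose d)) = regs (N + m) (Suc d)"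
  shows "\<exists>A. arrangement (N + m) d A \<and> finite (regions d A) \<and> card (regions d A) = f"
proof -
  obtain b :: "nat \<Rightarrow> (nat \<Rightarrow> real) \<Rightarrow> real" where b: "\<forall>i. linear (b i)"
    "\<forall>i<N + m. \<forall>j<N + m. indep_on (coord_space (Suc d)) b {i, j}"
    "card (cells (coord_space (Suc d)) b {..<N + m})
      + 2 * ((m + 1) * (\<Sum>k\<leftarrow>ks. deficit k d) + s + ((N - 1) choose d)) = 2 * regs (N + m) (Suc d)"
    using cone_arrangement[OF has_dim_coord_space, of d N m ks s] assms by blast
  then obtain A where A: "arrangement (N + m) d A" "finite (regions d A)"
    "2 * card (regions d A) = card (cells (coord_space (Suc d)) b {..<N + m})"
    using arrangement_of_forms[of b "N + m" d] assms by auto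
  define t where "t = (m + 1) * (\<Sum>k\<leftarrow>ks. deficit k d) + s + ((N - 1) choose d)"
  have "card (regions d A) = f"
    using A(3) b(3)[folded t_def] f[folded t_def] by linarith
  then show ?thesis using A by blast
qed

text \<open>The empty list of groups is the generic arrangement, which attains the upper
  bound.\<close>

lemma f_max_eq:
  assumes "d \<ge> 2" "n \<ge> 1"
  shows "f_max n d = regs n (Suc d)"
proof -
  let ?S = "{card (regions d A) |A. arrangement n d A}"
  have "?S \<subseteq> {..regs n (Suc d)}" using card_regions_le assms by auto
  then have "finite ?S" "\<And>x. x \<in> ?S \<Longrightarrow> x \<le> regs n (Suc d)"
    using finite_subset by (blast, auto)
  moreover obtain A where "arrangement n d A" "card (regions d A) = regs n (Suc d)"
    using realize_disjoint_points[of d "[]" n "regs n (Suc d)"] assms by auto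
  then have "regs n (Suc d) \<in> ?S" by (intro CollectI exI[of _ A]) simp
  ultimately show ?thesis unfolding f_max_def by (rule Max_eqI)
qed

section \<open>Sums of binomial deficits\<close>

text \<open>A polynomial of degree \<open>e\<close> in \<open>x\<close> is eventually below one of
  degree \<open>Suc e\<close> in \<open>x / K\<close>. After the largest group is chosen greedily,
  the remainder is therefore a matter of far smaller groups.\<close>

lemma binomial_le_binomial_div:
  fixes e K :: nat
  assumes "K \<ge> 1"
  shows "\<exists>x0. \<forall>x\<ge>x0. x choose e \<le> (x div K) choose Suc e"
proof (intro exI allI impI)
  \<comment> \<open>\<open>2 * K\<close> comes from \<open>x \<le> 2 * K * q\<close>, and
    \<open>Suc e\<close> from the bound \<open>(q / Suc e) ^ Suc e\<close> below the binomial. Then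
    \<open>x ^ e \<le> (x / ?L) ^ Suc e\<close> holds once \<open>x \<ge> ?L ^ Suc e\<close>; the
    extra summand makes \<open>q\<close> large enough.\<close>
  let ?L = "2 * K * Suc e"
  fix x assume x: "x \<ge> ?L ^ Suc e + ?L"
  have xL: "x \<ge> ?L" and xp: "x \<ge> ?L ^ Suc e" using x by linarith+
  define q where "q = x div K"
  have "2 * Suc e * K \<le> x" using xL by (simp only: mult_ac)
  then have "2 * Suc e \<le> q" using assms by (simp add: q_def less_eq_div_iff_mult_less_eq)
  moreover have "x < K * q + K"
    using assms by (simp add: q_def) (metis add.commute mult.commute div_mult_mod_eq mod_less_divisor nat_add_left_cancel_less Suc_le_lessD)
  moreover have "K \<le> K * q" using \<open>2 * Suc e \<le> q\<close> by simp
  ultimately have "x \<le> K * q + K * q" by linarith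
  then have q: "Suc e \<le> q" "x \<le> 2 * K * q" using \<open>2 * Suc e \<le> q\<close> by simp_all
  have "e \<le> x" using xL assms by (cases K) auto
  then have "real (x choose e) \<le> real x ^ e" 
    using binomial_le_pow[of e x] by (metis of_nat_le_iff of_nat_power)
  also have "\<dots> \<le> (real x / real ?L) ^ Suc e"
  proof -
    have "real ?L ^ Suc e \<le> real x" using xp by (metis of_nat_le_iff of_nat_power)
    then have "real x ^ e * real ?L ^ Suc e \<le> real x ^ e * real x"
      by (intro mult_left_mono) simp_all
    also have "\<dots> = real x ^ Suc e" by (simp only: power_Suc2)
    finally have "real x ^ e * real ?L ^ Suc e \<le> real x ^ Suc e" .
    moreover have "0 < ?L" using assms by simp
    then have "0 < real ?L ^ Suc e" by (intro zero_less_power) (simp only: of_nat_0_less_iff)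
    ultimately show ?thesis by (simp only: power_divide pos_le_divide_eq)
  qed
  also have "\<dots> \<le> (real q / real (Suc e)) ^ Suc e"
  proof (intro power_mono)
    have "real x \<le> real (2 * K * q)" using q(2) by (simp only: of_nat_le_iff)
    then have "real x / real (2 * K) \<le> real q"
      using assms by (simp add: pos_divide_le_eq mult.commute)
    then have "real x / real (2 * K) / real (Suc e) \<le> real q / real (Suc e)"
      by (intro divide_right_mono) simp_all
    then show "real x / real ?L \<le> real q / real (Suc e)"
      by (simp only: of_nat_mult divide_divide_eq_left)
  qed simp
  also have "\<dots> \<le> real (q choose Suc e)"
    using binomial_ge_n_over_k_pow_k[OF q(1), where 'a = real] by simp
  finally show "x choose e \<le> (x div K) choose Suc e" by (simp add: q_def)
qed

lemma deficit_Suc_Suc: "deficit (Suc x) (Suc e) = x choose e"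
  by (simp add: deficit_def)

text \<open>Greedy expansion: a group of \<open>Suc x\<close> hyperplanes removes
  \<open>x choose Suc e\<close> and leaves less than \<open>x choose e\<close>, which is handled by
  recursion at \<open>x div 4\<close>.\<close>

lemma deficit_sum_coarse:
  "\<exists>A. \<forall>x g. g < Suc x choose Suc e \<longrightarrow>
    (\<exists>ks. (\<Sum>k\<leftarrow>ks. deficit k (Suc (Suc e))) = g \<and> sum_list ks \<le> A + 2 * x)"
proof -
  obtain x0 where x0: "\<And>x. x \<ge> x0 \<Longrightarrow> x choose e \<le> (x div 4) choose Suc e"
    using binomial_le_binomial_div[of 4 e] by auto
  define A where "A = Suc (Suc e) * (Suc (x0 + 2) choose Suc e)"
  have "\<exists>ks. (\<Sum>k\<leftarrow>ks. deficit k (Suc (Suc e))) = g \<and> sum_list ks \<le> A + 2 * x"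
    if "g < Suc x choose Suc e" for x g
    using that
  proof (induction x arbitrary: g rule: less_induct)
    case (less x)
    show ?case
    proof (cases "x < x0 + 2")
      case True
      then have "Suc x choose Suc e \<le> Suc (x0 + 2) choose Suc e"
        by (intro binomial_right_mono) simp
      then have "g * Suc (Suc e) \<le> A"
        using less.prems unfolding A_def by (subst mult.commute) (intro mult_le_mono, simp_all)
      \<comment> \<open>Below the threshold, groups of size \<open>Suc (Suc e)\<close> with deficit
        1 suffice; their total size is absorbed by \<open>A\<close>.\<close>
      then show ?thesis
        by (intro exI[of _ "replicate g (Suc (Suc e))"])
          (simp add: sum_list_replicate deficit_Suc_Suc)
    next
      case False
      show ?thesis
      proof (cases "g < x choose Suc e")
        case True
        then obtain ks where "(\<Sum>k\<leftarrow>ks. deficit k (Suc (Suc e))) = g" "sum_list ks \<le> A + 2 * (x - 1)"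
          using less.IH[of "x - 1" g] False by auto
        then show ?thesis by (intro exI[of _ ks]) simp
      next
        case g: False
        then have "g - (x choose Suc e) < x choose e" using less.prems by simp
        also have "\<dots> \<le> (x div 4) choose Suc e" using x0 False by simp
        also have "\<dots> \<le> Suc (x div 4) choose Suc e" by (intro binomial_right_mono) simp
        finally obtain ks where "(\<Sum>k\<leftarrow>ks. deficit k (Suc (Suc e))) = g - (x choose Suc e)"
          "sum_list ks \<le> A + 2 * (x div 4)"
          using less.IH[of "x div 4"] False by auto
        \<comment> \<open>The sizes add up to at most \<open>Suc x + A + x / 2\<close>, within the
          bound since \<open>x \<ge> 2\<close>.\<close>
        then show ?thesis
          using g False by (intro exI[of _ "Suc x # ks"]) (simp add: deficit_Suc_Suc)
      qed
    qed
  qed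
  then show ?thesis by blast
qed

text \<open>One more greedy step in front of the coarse expansion. The remainder is represented at
  \<open>y div (2 * K)\<close>, so the factor 2 of the coarse bound shrinks to an overhead of
  \<open>y / K\<close>.\<close>

lemma deficit_sum_fine:
  assumes "K \<ge> 1"
  shows "\<exists>A. \<forall>x g. g < Suc x choose Suc e \<longrightarrow>
    (\<exists>ks. (\<Sum>k\<leftarrow>ks. deficit k (Suc (Suc e))) = g \<and> K * sum_list ks \<le> Suc K * x + A)"
proof -
  obtain A0 where A0: "\<And>x g. g < Suc x choose Suc e \<Longrightarrow>
    \<exists>ks. (\<Sum>k\<leftarrow>ks. deficit k (Suc (Suc e))) = g \<and> sum_list ks \<le> A0 + 2 * x"
    using deficit_sum_coarse by blast
  obtain x0 where x0: "\<And>x. x \<ge> x0 \<Longrightarrow> x choose e \<le> (x div (2 * K)) choose Suc e"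
    using binomial_le_binomial_div[of "2 * K" e] assms by auto
  define A where "A = K * (1 + A0) + K * (2 * x0)"
  have "\<exists>ks. (\<Sum>k\<leftarrow>ks. deficit k (Suc (Suc e))) = g \<and> K * sum_list ks \<le> Suc K * x + A"
    if "g < Suc x choose Suc e" for x g
  proof -
    define Q where "Q y \<longleftrightarrow> g < Suc y choose Suc e" for y
    define y where "y = Least Q"
    have Qx: "Q x" using that by (simp only: Q_def)
    have y: "g < Suc y choose Suc e" using LeastI[of Q, OF Qx] unfolding y_def Q_def .
    have yx: "y \<le> x" unfolding y_def using Qx by (rule Least_le)
    have ge: "y choose Suc e \<le> g"
    proof (cases y)
      case (Suc z)
      then have "\<not> Q z" using not_less_Least[of z Q] unfolding y_def by simp
      then show ?thesis using Suc by (simp only: Q_def not_less)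
    qed simp
    have "\<exists>ks. (\<Sum>k\<leftarrow>ks. deficit k (Suc (Suc e))) = g \<and> K * sum_list ks \<le> Suc K * y + A"
    proof (cases "y < x0")
      case True
      obtain ks where ks: "(\<Sum>k\<leftarrow>ks. deficit k (Suc (Suc e))) = g" "sum_list ks \<le> A0 + 2 * y"
        using A0[OF y] by blast
      then have "K * sum_list ks \<le> K * (A0 + 2 * x0)" using True by (intro mult_le_mono) auto
      also have "\<dots> \<le> A" by (simp add: A_def algebra_simps)
      finally show ?thesis using ks(1) by (intro exI[of _ ks]) simp
    next
      case False
      then have "g - (y choose Suc e) < y choose e" using y ge by simp
      also have "\<dots> \<le> (y div (2 * K)) choose Suc e" using x0 False by simp
      also have "\<dots> \<le> Suc (y div (2 * K)) choose Suc e" by (intro binomial_right_mono) simp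
      finally obtain ks where ks: "(\<Sum>k\<leftarrow>ks. deficit k (Suc (Suc e))) = g - (y choose Suc e)"
        "sum_list ks \<le> A0 + 2 * (y div (2 * K))"
        using A0 by blast
      have "K * (2 * (y div (2 * K))) \<le> y" by (metis div_times_less_eq_dividend mult.assoc mult.commute)
      moreover have "K * sum_list ks \<le> K * A0 + K * (2 * (y div (2 * K)))"
        using mult_le_mono2[OF ks(2), of K] by (simp add: algebra_simps)
      ultimately have "K * sum_list (Suc y # ks) \<le> Suc K * y + A"
        by (simp add: A_def algebra_simps)
      moreover have "(\<Sum>k\<leftarrow>Suc y # ks. deficit k (Suc (Suc e))) = g"
        using ks(1) ge by (simp add: deficit_Suc_Suc)
      ultimately show ?thesis by blast
    qed
    then obtain ks where "(\<Sum>k\<leftarrow>ks. deficit k (Suc (Suc e))) = g" "K * sum_list ks \<le> Suc K * y + A"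
      by blast
    moreover have "Suc K * y \<le> Suc K * x" using yx by (intro mult_le_mono2)
    ultimately show ?thesis by (intro exI[of _ ks]) linarith
  qed
  then show ?thesis by blast
qed

text \<open>Lowering the upper index by one loses at most the fraction \<open>Suc e / N\<close> of
  \<open>N choose Suc e\<close>, because
  \<open>N * ((N - 1) choose e) = Suc e * (N choose Suc e)\<close> and later losses are no
  larger.\<close>

lemma binomial_diff_le:
  assumes "j \<le> N"
  shows "N * (N choose Suc e) \<le> N * ((N - j) choose Suc e) + j * Suc e * (N choose Suc e)"
  using assms
proof (induction j)
  case (Suc j)
  then obtain M where M: "N - j = Suc M" "N - Suc j = M" by (metis Suc_diff_Suc Suc_le_lessD)
  have "N * (M choose e) \<le> N * ((N - 1) choose e)"
    using M by (intro mult_le_mono2 binomial_right_mono) linarith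
  also have "\<dots> = Suc e * (N choose Suc e)"
    using times_binomial_minus1_eq[of "Suc e" N] by simp
  finally have *: "N * (M choose e) \<le> Suc e * (N choose Suc e)" .
  have "N * (N choose Suc e) \<le> N * (Suc M choose Suc e) + j * Suc e * (N choose Suc e)"
    using Suc M by simp
  also have "\<dots> = N * (M choose Suc e) + N * (M choose e) + j * Suc e * (N choose Suc e)"
    by (simp add: algebra_simps)
  finally show ?case using * M by (simp add: algebra_simps)
qed simp

lemma binomial_two_thirds:
  assumes "3 * j * Suc e \<le> N"
  shows "2 * (N choose Suc e) \<le> 3 * ((N - j) choose Suc e)"
proof (cases "N = 0")
  case False
  define a where "a = N choose Suc e"
  define c where "c = (N - j) choose Suc e"
  have "j \<le> N" using assms by simp
  then have "N * a \<le> N * c + j * Suc e * a" unfolding a_def c_def by (rule binomial_diff_le)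
  moreover have "3 * j * Suc e * a \<le> N * a" using assms by (intro mult_le_mono1)
  then have "3 * (j * Suc e * a) \<le> N * a" by (simp only: mult.assoc)
  ultimately have "2 * (N * a) \<le> 3 * (N * c)" by linarith
  then have "N * (2 * a) \<le> N * (3 * c)" by (simp only: mult.left_commute)
  then show ?thesis using False unfolding a_def c_def by simp
qed simp

text \<open>The two alternatives are the two families in projective dimension \<open>Suc e\<close>.
  Once disjoint points no longer fit, \<open>g\<close> is so large that a cone with small
  \<open>m\<close> accounts for most of it.\<close>

theorem deficit_representation:
  assumes "e \<ge> 1"
  shows "\<exists>n0. \<forall>n\<ge>n0. \<forall>g \<le> (n - 1) choose Suc e.
    (\<exists>ks. (\<Sum>k\<leftarrow>ks. deficit k (Suc (Suc e))) = g \<and> sum_list ks < n) \<or>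
    (\<exists>m ks s. m \<ge> 2 \<and> m < n \<and> sum_list ks + s * e \<le> n - m \<and>
      (m + 1) * (\<Sum>k\<leftarrow>ks. deficit k (Suc e)) + s + ((n - m - 1) choose Suc e) = g)"
proof -
  obtain e' where e: "e = Suc e'" using assms by (cases e) auto
  \<comment> \<open>At least about \<open>n / (3 * e)\<close> places will be free, and
    \<open>K\<close> times that is about \<open>(e + 3) * n\<close>: one \<open>n\<close> for the
    greedy overhead, \<open>e + 1\<close> for \<open>m\<close> and \<open>s * e\<close>, and one for
    the constants.\<close>
  define K where "K = 3 * e * (e + 3)"
  have K: "K \<ge> 1" using assms by (simp add: K_def)
  obtain A1 where A1: "\<And>x g. g < Suc x choose Suc e \<Longrightarrow>
    \<exists>ks. (\<Sum>k\<leftarrow>ks. deficit k (Suc (Suc e))) = g \<and> K * sum_list ks \<le> Suc K * x + A1"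
    using deficit_sum_fine[OF K, of e] by blast
  obtain A2 where A2: "\<And>x g. g < Suc x choose e \<Longrightarrow>
    \<exists>ks. (\<Sum>k\<leftarrow>ks. deficit k (Suc e)) = g \<and> K * sum_list ks \<le> Suc K * x + A2"
    using deficit_sum_fine[OF K, of e'] unfolding e by blast
  define c where "c = A1 + 2 * K + 2"
  define n0 where "n0 = (e + 3) * (2 + 3 * e) + A2 + (e + 1) * c + A1 + c + 9 * e + 10"
  have "(\<exists>ks. (\<Sum>k\<leftarrow>ks. deficit k (Suc (Suc e))) = g \<and> sum_list ks < n) \<or>
    (\<exists>m ks s. m \<ge> 2 \<and> m < n \<and> sum_list ks + s * e \<le> n - m \<and>
      (m + 1) * (\<Sum>k\<leftarrow>ks. deficit k (Suc e)) + s + ((n - m - 1) choose Suc e) = g)"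
    if n: "n \<ge> n0" and g: "g \<le> (n - 1) choose Suc e" for n g
  proof -
    \<comment> \<open>The largest \<open>x\<close> for which every deficit below
      \<open>Suc x choose Suc e\<close> fits into \<open>n - 1\<close> hyperplanes by the fine
      expansion.\<close>
    define x where "x = (K * (n - 1) - A1) div Suc K"
    have n_big: "n \<ge> A1 + 10" "n \<ge> c + 10" "n \<ge> 9 * e + 10" using n by (auto simp: n0_def)
    have "1 * (n - 1) \<le> K * (n - 1)" using K by (intro mult_le_mono1)
    then have A1K: "A1 \<le> K * (n - 1)" using n_big by linarith
    have x1: "Suc K * x \<le> K * (n - 1) - A1" by (simp only: x_def times_div_less_eq_dividend)
    have x2: "K * (n - 1) - A1 < Suc K * Suc x"
      using dividend_less_times_div[of "Suc K" "K * (n - 1) - A1", OF zero_less_Suc]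
      unfolding x_def by (simp only: mult_Suc_right)
    show ?thesis
    proof (cases "g < Suc x choose Suc e")
      case True
      then obtain ks where ks: "(\<Sum>k\<leftarrow>ks. deficit k (Suc (Suc e))) = g" "K * sum_list ks \<le> Suc K * x + A1"
        using A1 by blast
      then have "K * sum_list ks \<le> K * (n - 1)" using x1 A1K by linarith
      then have "sum_list ks < n" using K n_big by simp
      then show ?thesis using ks by blast
    next
      case False
      \<comment> \<open>The least \<open>m\<close> with \<open>P m\<close> gives the largest cone
        whose cost does not exceed \<open>g\<close>. Failure of the first family makes
        \<open>m1\<close> a candidate, which bounds \<open>m\<close> by about
        \<open>n / Suc K\<close>.\<close>
      define P where "P m \<longleftrightarrow> m \<ge> 2 \<and> (n - m - 1) choose Suc e \<le> g" for m
      define m1 where "m1 = max 2 (n - 2 - x)"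
      have "P m1"
      proof -
        have "(n - m1 - 1) choose Suc e \<le> Suc x choose Suc e"
          by (intro binomial_right_mono) (simp add: m1_def)
        then show ?thesis using False by (simp add: P_def m1_def)
      qed
      define m where "m = (LEAST m. P m)"
      have Pm: "P m" unfolding m_def using \<open>P m1\<close> by (rule LeastI)
      have "m \<le> m1" unfolding m_def using \<open>P m1\<close> by (rule Least_le)
      have m2: "m \<ge> 2" using Pm by (simp add: P_def)
      have mK: "Suc K * m \<le> n + c"
      proof -
        have "Suc K * (n - 2 - x) \<le> n + A1"
        proof (cases "n - 2 - x = 0")
          case False
          then have "n - 1 = (n - 2 - x) + Suc x" by simp
          then have "Suc K * (n - 1) = Suc K * (n - 2 - x) + Suc K * Suc x"
            by (metis distrib_left)
          then show ?thesis using x2 A1K by simp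
        qed simp
        moreover have "Suc K * m \<le> Suc K * m1" using \<open>m \<le> m1\<close> by (intro mult_le_mono2)
        moreover have "Suc K * 2 \<le> n + c" by (simp add: c_def)
        moreover have "n + A1 \<le> n + c" by (simp add: c_def)
        moreover have "m1 = 2 \<or> m1 = n - 2 - x" by (simp add: m1_def max_def)
        ultimately show ?thesis using le_trans by metis
      qed
      have "m < n"
      proof -
        have "2 * m \<le> Suc K * m" using K by (intro mult_le_mono1) simp
        then show ?thesis using mK n_big by linarith
      qed
      define p where "p = n - m - 1"
      define r where "r = g - (p choose Suc e)"
      have rg: "r + (p choose Suc e) = g" using Pm by (simp add: P_def r_def p_def)
      define \<delta> where "\<delta> = r div (m + 1)"
      define s where "s = r mod (m + 1)"
      have rds: "(m + 1) * \<delta> + s = r" unfolding \<delta>_def s_def by (rule mult_div_mod_eq)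
      have "s \<le> m" unfolding s_def using mod_less_divisor[of "m + 1" r] by linarith
      \<comment> \<open>For \<open>m = 2\<close> up to two Pascal steps lie between \<open>g\<close>
        and the cone, but they are divided by 3. For larger \<open>m\<close> minimality leaves only
        one step.\<close>
      have \<delta>: "3 * \<delta> \<le> 2 * ((n - 2) choose e)"
      proof (cases "m = 2")
        case True
        define q where "q = n - 3"
        have q: "n = q + 3" using n_big by (simp add: q_def)
        have "(n - 1) choose Suc e = (q choose Suc e) + (q choose e) + (Suc q choose e)"
          by (simp add: q numeral_2_eq_2)
        moreover have "q choose e \<le> Suc q choose e" by (intro binomial_right_mono) simp
        moreover have "p = q" using True q by (simp add: p_def)
        then have "r + (q choose Suc e) = g" using rg by simp
        ultimately have "r \<le> 2 * (Suc q choose e)" using g by linarith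
        moreover have "3 * \<delta> \<le> r" using rds True by simp
        moreover have "Suc q = n - 2" using q by simp
        ultimately show ?thesis by simp
      next
        case False
        then have "\<not> P (m - 1)" using not_less_Least[of "m - 1" P] m2 unfolding m_def by simp
        moreover have "n - (m - 1) - 1 = Suc p" "m - 1 \<ge> 2" using False m2 \<open>m < n\<close> by (auto simp: p_def)
        ultimately have "g < Suc p choose Suc e" by (simp add: P_def)
        then have "r \<le> p choose e" using rg by simp
        also have "\<dots> \<le> (n - 2) choose e" using m2 by (intro binomial_right_mono) (simp add: p_def)
        finally have "r \<le> (n - 2) choose e" .
        moreover have "3 * \<delta> \<le> (m + 1) * \<delta>" using m2 by (intro mult_le_mono1) simp
        ultimately show ?thesis using rds by linarith
      qed
      \<comment> \<open>By \<open>binomial_two_thirds\<close> the upper index may be lowered by this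
        much at the price of a third, the slack left in the bound on
        \<open>\<delta>\<close>.\<close>
      define j where "j = (n - 2) div (3 * e)"
      have j1: "3 * j * e \<le> n - 2"
        unfolding j_def by (metis div_times_less_eq_dividend mult.assoc mult.commute)
      have j2: "n - 2 < 3 * e * j + 3 * e"
        using dividend_less_times_div[of "3 * e" "n - 2"] assms by (simp add: j_def add.commute)
      define y where "y = n - 2 - j"
      have "2 * ((n - 2) choose e) \<le> 3 * (y choose e)"
        using binomial_two_thirds[of j e' "n - 2"] j1 by (simp add: e y_def)
      then have "\<delta> \<le> y choose e" using \<delta> by linarith
      also have "\<dots> < Suc y choose e"
      proof -
        have "3 * j * 1 \<le> 3 * j * e" using assms by (intro mult_le_mono2)
        then have "e' \<le> y" using j1 n_big by (simp add: y_def e)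
        then show ?thesis by (simp add: e)
      qed
      finally obtain ks where ks: "(\<Sum>k\<leftarrow>ks. deficit k (Suc e)) = \<delta>" "K * sum_list ks \<le> Suc K * y + A2"
        using A2 by blast
      \<comment> \<open>Multiplied by \<open>K\<close> to stay in the integers. Since
        \<open>s \<le> m\<close>, the multiple \<open>(e + 1) * m\<close> covers both the
        \<open>m\<close> outside forms and the \<open>s * e\<close> cone forms used for
        vertices.\<close>
      have "sum_list ks + (e + 1) * m \<le> n"
      proof -
        have "K * ((e + 1) * m) \<le> (e + 1) * (n + c)"
        proof -
          have "K * m \<le> n + c" using mK by simp
          from mult_le_mono2[OF this, of "e + 1"] show ?thesis by (simp only: mult_ac)
        qed
        moreover have "Suc K * y + Suc K * j = Suc K * (n - 2)"
        proof -
          have "j \<le> 3 * j * e" using assms by (cases e) simp_all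
          also note j1
          finally have "y + j = n - 2" by (simp add: y_def)
          then show ?thesis by (metis distrib_left)
        qed
        moreover have "(e + 3) * (n - 2) \<le> K * j + (e + 3) * (3 * e)"
        proof -
          have "(e + 3) * (n - 2) \<le> (e + 3) * (3 * e * j + 3 * e)" using j2 by (intro mult_le_mono2) simp
          then show ?thesis by (simp add: K_def algebra_simps)
        qed
        moreover have "Suc K * (n - 2) + (e + 1) * (n + c) + A2 + (e + 3) * (3 * e) \<le> K * n + (e + 3) * (n - 2)"
        proof -
          have "n = (n - 2) + 2" using n_big by simp
          then have "(e + 3) * n = (e + 3) * (n - 2) + (e + 3) * 2" by (metis distrib_left)
          moreover have "Suc K * (n - 2) \<le> K * n + n" using mult_le_mono2[of "n - 2" n "Suc K"] by simp
          moreover have "n \<ge> (e + 3) * (2 + 3 * e) + A2 + (e + 1) * c" using n by (simp add: n0_def)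
          ultimately show ?thesis by (simp add: algebra_simps)
        qed
        ultimately have "K * sum_list ks + K * ((e + 1) * m) \<le> K * n"
          using ks(2) by (simp only: mult_Suc)
        then have "K * (sum_list ks + (e + 1) * m) \<le> K * n" by (simp only: distrib_left)
        then show ?thesis using K by simp
      qed
      moreover have "(e + 1) * m = m * e + m" by simp
      moreover have "s * e \<le> m * e" using \<open>s \<le> m\<close> by (rule mult_le_mono1)
      ultimately have "sum_list ks + s * e \<le> n - m" by linarith
      moreover have "(m + 1) * (\<Sum>k\<leftarrow>ks. deficit k (Suc e)) + s + ((n - m - 1) choose Suc e) = g"
        unfolding ks(1) rds using rg by (simp add: p_def)
      ultimately show ?thesis using m2 \<open>m < n\<close> by blast
    qed
  qed
  then show ?thesis by blast
qed

theorem theorem2: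
  fixes d :: nat
  assumes "d \<ge> 4"
  shows "\<exists>N. \<forall>n\<ge>N. \<forall>f. f_max n (d - 1) \<le> f \<and> f \<le> f_max n d \<longrightarrow>
           (\<exists>A. arrangement n d A \<and> finite (regions d A) \<and> card (regions d A) = f)"
proof -
  obtain e where d: "d = Suc e" "e \<ge> 3" using assms by (cases d) auto
  obtain n0 where n0: "\<forall>n\<ge>n0. \<forall>g \<le> (n - 1) choose Suc e.
    (\<exists>ks. (\<Sum>k\<leftarrow>ks. deficit k (Suc (Suc e))) = g \<and> sum_list ks < n) \<or>
    (\<exists>m ks s. m \<ge> 2 \<and> m < n \<and> sum_list ks + s * e \<le> n - m \<and>
      (m + 1) * (\<Sum>k\<leftarrow>ks. deficit k (Suc e)) + s + ((n - m - 1) choose Suc e) = g)"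
    using deficit_representation[of e] d(2) by auto
  have "\<exists>A. arrangement n d A \<and> finite (regions d A) \<and> card (regions d A) = f"
    if n: "n \<ge> max n0 1" and f: "f_max n (d - 1) \<le> f" "f \<le> f_max n d" for n f
  proof -
    have "regs n d \<le> f" "f \<le> regs n (Suc d)"
      using f f_max_eq[of "d - 1" n] f_max_eq[of d n] n d by auto
    \<comment> \<open>The two bounds on \<open>f\<close> differ by one binomial coefficient, so the
      deficit \<open>g\<close> runs exactly through the range of
      \<open>deficit_representation\<close>.\<close>
    moreover have "regs n (Suc d) = regs n d + ((n - 1) choose d)" by (simp add: regs_def)
    ultimately obtain g where g: "f + g = regs n (Suc d)" "g \<le> (n - 1) choose d"
      using le_Suc_ex[of f "regs n (Suc d)"] by auto
    consider ks where "(\<Sum>k\<leftarrow>ks. deficit k (Suc d)) = g" "sum_list ks < n"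
      | m ks s where "m \<ge> 2" "m < n" "sum_list ks + s * (d - 1) \<le> n - m"
        "(m + 1) * (\<Sum>k\<leftarrow>ks. deficit k d) + s + ((n - m - 1) choose d) = g"
      using n0[rule_format, of n g] n g(2) unfolding d(1) diff_Suc_1 by auto
    then show ?thesis
    proof cases
      case 1
      then show ?thesis using realize_disjoint_points[of d ks n f] g(1) d by simp
    next
      case 2
      then show ?thesis using realize_cone[of d m "n - m" ks s f] g(1) d by simp
    qed
  qed
  then show ?thesis by blast
qed

end
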